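(* For each integer $k\ge1$ let $\omega_{12k^2}\subset\mathbb{S}^2$ be the HEALPix configuration with $N=12k^2$ points. Then the sequence of HEALPix configurations $\{\omega_{12k^2}\}_{k\ge1}$ is equidistributed and quasi-uniform.
   Context: $\mathbb{S}^2=\{x\in\mathbb{R}^3:|x|=1\}$, $|\cdot|$ is the Euclidean norm, $\sigma$ is the normalized surface area measure ($\sigma(\mathbb{S}^2)=1$). Spherical coordinates $(\phi,\theta)$ denote the point $(\sin\phi\cos\theta,\sin\phi\sin\theta,\cos\phi)$. HEALPix configuration with parameter $k\in\mathbb{N}$: it consists of the following points $(\phi,\theta)$. (i) Polar rings: for each $i=1,\dots,k$ and each sign $\pm$, the $4i$ points with $$\cos\phi=\pm\Bigl(1-\frac{i^2}{3k^2}\Bigr),\qquad \theta=\frac{\pi}{2i}\Bigl(j-\frac12\Bigr),\quad j=1,\dots,4i.$$ (ii) Equatorial rings: for each $i=k+1,\dots,2k$ and each sign $\pm$ (the two signs giving the same ring, counted once, when $i=2k$), the $4k$ points with $$\cos\phi=\pm\Bigl(\frac43-\frac{2i}{3k}\Bigr),\qquad \theta=\frac{\pi}{2k}\Bigl(j-\frac s2\Bigr),\quad j=1,\dots,4k,\qquad s=(i-k+1)\bmod 2\in\{0,1\}.$$ There are $2k-1$ rings in (ii), and the total number of points is $12k^2$. A sequence of configurations $\omega_N$ with $|\omega_N|=N$, $N$ ranging over an infinite set of integers, is equidistributed if the normalized counting measures $\nu_N(A)=\frac1N|A\cap\omega_N|$ converge weak-star to $\sigma$ (i.e. $\int f\,d\nu_N\to\int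 f\,d\sigma$ for all continuous $f$ on $\mathbb{S}^2$). For a finite configuration $\omega$ with at least two points, $\delta(\omega)=\min_{x\ne y\in\omega}|x-y|$, $\eta(\omega)=\max_{y\in\mathbb{S}^2}\min_{x\in\omega}|x-y|$, and $\gamma(\omega)=\eta(\omega)/\delta(\omega)$ is the mesh ratio. A sequence of configurations is quasi-uniform if its sequence of mesh ratios is bounded. *)

theory Defs
  imports "HOL-Analysis.Analysis"
begin

abbreviation S2 :: "(real ^ 3) set" where
  "S2 \<equiv> sphere 0 1"

definition spherical :: "real \<Rightarrow> real \<Rightarrow> real ^ 3" where
  "spherical \<phi> \<theta> = vector [sin \<phi> * cos \<theta>, sin \<phi> * sin \<theta>, cos \<phi>]"

text \<open>The Borel sets of the sphere.\<close>

abbreviation S2_borel :: "(real ^ 3) measure" where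
  "S2_borel \<equiv> restrict_space borel S2"

text \<open>
  Normalized surface area, computed in spherical coordinates.  The area element
  is the norm of the cross product of the partial derivatives of the parametrization,
  which is \<open>sin \<phi>\<close> (lemma \<open>spherical_area_element\<close>), and the total area is \<open>4 * pi\<close>
  (lemma \<open>emeasure_sphere_measure_S2\<close>).  The parametrization is injective except on
  a null set of the boundary of the rectangle.
\<close>

definition sphere_measure :: "(real ^ 3) measure" where
  "sphere_measure =
     distr
       (density (restrict_space lborel ({0..pi} \<times> {0..2 * pi}))
          (\<lambda>(\<phi>, \<theta>). ennreal (sin \<phi> / (4 * pi))))
       S2_borel
       (\<lambda>(\<phi>, \<theta>). spherical \<phi> \<theta>)"

definition healpix_polar :: "nat \<Rightarrow> (real ^ 3) set" where
  "healpix_polar k =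
     {spherical \<phi> \<theta> | \<phi> \<theta>. \<exists>i\<in>{1..k}. \<exists>j\<in>{1..4 * i}. \<exists>\<epsilon>\<in>{1, -1}.
        0 \<le> \<phi> \<and> \<phi> \<le> pi \<and>
        cos \<phi> = \<epsilon> * (1 - (real i)\<^sup>2 / (3 * (real k)\<^sup>2)) \<and>
        \<theta> = pi / (2 * real i) * (real j - 1 / 2)}"

text \<open>Since \<open>i > k\<close>, the natural-number subtraction \<open>i - k\<close> below does not truncate.\<close>

definition healpix_equatorial :: "nat \<Rightarrow> (real ^ 3) set" where
  "healpix_equatorial k =
     {spherical \<phi> \<theta> | \<phi> \<theta>. \<exists>i\<in>{k + 1..2 * k}. \<exists>j\<in>{1..4 * k}. \<exists>\<epsilon>\<in>{1, -1}.
        0 \<le> \<phi> \<and> \<phi> \<le> pi \<and>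
        cos \<phi> = \<epsilon> * (4 / 3 - 2 * real i / (3 * real k)) \<and>
        \<theta> = pi / (2 * real k) * (real j - real ((i - k + 1) mod 2) / 2)}"

definition healpix :: "nat \<Rightarrow> (real ^ 3) set" where
  "healpix k = healpix_polar k \<union> healpix_equatorial k"

definition normalized_counting_measure :: "(real ^ 3) set \<Rightarrow> (real ^ 3) measure" where
  "normalized_counting_measure \<omega> = distr (uniform_count_measure \<omega>) S2_borel (\<lambda>x. x)"

text \<open>
  A sequence of configurations is a family indexed by its numbers of points \<open>N\<close>,
  with \<open>N\<close> ranging over an infinite set \<open>I\<close>; the values of \<open>\<omega>\<close> outside \<open>I\<close> are irrelevant.
\<close>

definition config_sequence :: "nat set \<Rightarrow> (nat \<Rightarrow> (real ^ 3) set) \<Rightarrow> bool" where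
  "config_sequence I \<omega> \<longleftrightarrow>
     infinite I \<and> (\<forall>N\<in>I. finite (\<omega> N) \<and> \<omega> N \<subseteq> S2 \<and> card (\<omega> N) = N)"

text \<open>The filter \<open>inf sequentially (principal I)\<close> expresses \<open>N \<rightarrow> \<infinity>\<close> within \<open>I\<close>.\<close>

definition equidistributed :: "nat set \<Rightarrow> (nat \<Rightarrow> (real ^ 3) set) \<Rightarrow> bool" where
  "equidistributed I \<omega> \<longleftrightarrow>
     config_sequence I \<omega> \<and>
     (\<forall>f :: real ^ 3 \<Rightarrow> real. continuous_on S2 f \<longrightarrow>
        ((\<lambda>N. integral\<^sup>L (normalized_counting_measure (\<omega> N)) f)
           \<longlongrightarrow> integral\<^sup>L sphere_measure f) (inf sequentially (principal I)))"

definition separation :: "(real ^ 3) set \<Rightarrow> real" where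
  "separation \<omega> = Min {norm (x - y) | x y. x \<in> \<omega> \<and> y \<in> \<omega> \<and> x \<noteq> y}"

text \<open>
  The supremum is a maximum for finite nonempty \<open>\<omega>\<close>, as a continuous function is
  maximized over a compact set.
\<close>

definition covering_radius :: "(real ^ 3) set \<Rightarrow> real" where
  "covering_radius \<omega> = (SUP y\<in>S2. MIN x\<in>\<omega>. norm (x - y))"

definition mesh_ratio :: "(real ^ 3) set \<Rightarrow> real" where
  "mesh_ratio \<omega> = covering_radius \<omega> / separation \<omega>"

text \<open>The condition \<open>N \<ge> 2\<close> ensures that all mesh ratios are meaningful.\<close>

definition quasi_uniform :: "nat set \<Rightarrow> (nat \<Rightarrow> (real ^ 3) set) \<Rightarrow> bool" where
  "quasi_uniform I \<omega> \<longleftrightarrow>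
     config_sequence I \<omega> \<and> (\<forall>N\<in>I. 2 \<le> N) \<and>
     bounded ((\<lambda>N. mesh_ratio (\<omega> N)) ` I)"

lemma norm_spherical [simp]: "norm (spherical \<phi> \<theta>) = 1"
proof -
  have "spherical \<phi> \<theta> \<bullet> spherical \<phi> \<theta>
        = (sin \<phi>)\<^sup>2 * ((cos \<theta>)\<^sup>2 + (sin \<theta>)\<^sup>2) + (cos \<phi>)\<^sup>2"
    by (simp only: spherical_def inner_vec_def sum_3 vector_3 inner_real_def power2_eq_square)
       algebra
  then show ?thesis by (simp add: norm_eq_sqrt_inner)
qed

lemma vector3_eq:
  "(vector [a, b, c] :: real ^ 3) = a *\<^sub>R axis 1 1 + b *\<^sub>R axis 2 1 + c *\<^sub>R axis 3 1"
  by (simp add: vec_eq_iff forall_3 axis_def)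

lemma spherical_partial_phi:
  "((\<lambda>\<phi>. spherical \<phi> \<theta>) has_vector_derivative
     vector [cos \<phi> * cos \<theta>, cos \<phi> * sin \<theta>, - sin \<phi>]) (at \<phi>)"
  unfolding spherical_def vector3_eq
  by (auto intro!: derivative_eq_intros)

lemma spherical_partial_theta:
  "((\<lambda>\<theta>. spherical \<phi> \<theta>) has_vector_derivative
     vector [- sin \<phi> * sin \<theta>, sin \<phi> * cos \<theta>, 0]) (at \<theta>)"
  unfolding spherical_def vector3_eq
  by (auto intro!: derivative_eq_intros simp: mult.commute)

lemma spherical_area_element:
  assumes "0 \<le> \<phi>" "\<phi> \<le> pi"
  shows "norm (cross3 (vector_derivative (\<lambda>\<phi>. spherical \<phi> \<theta>) (at \<phi>))
                      (vector_derivative (\<lambda>\<theta>. spherical \<phi> \<theta>) (at \<theta>))) = sin \<phi>"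
proof -
  let ?c = "cross3 (vector [cos \<phi> * cos \<theta>, cos \<phi> * sin \<theta>, - sin \<phi>])
                   (vector [- sin \<phi> * sin \<theta>, sin \<phi> * cos \<theta>, 0])"
  have "?c \<bullet> ?c
        = (sin \<phi>)\<^sup>2 * ((sin \<phi>)\<^sup>2 * ((cos \<theta>)\<^sup>2 + (sin \<theta>)\<^sup>2) + (cos \<phi>)\<^sup>2 * ((cos \<theta>)\<^sup>2 + (sin \<theta>)\<^sup>2)\<^sup>2)"
    by (simp only: cross3_def inner_vec_def sum_3 vector_3 inner_real_def power2_eq_square)
       algebra
  also have "\<dots> = (sin \<phi>)\<^sup>2" by simp
  finally show ?thesis
    using sin_ge_zero[OF assms]
    by (simp add: vector_derivative_at[OF spherical_partial_phi]
        vector_derivative_at[OF spherical_partial_theta] norm_eq_sqrt_inner)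
qed

lemma spherical_measurable:
  "(\<lambda>(\<phi>, \<theta>). spherical \<phi> \<theta>) \<in> borel \<rightarrow>\<^sub>M S2_borel"
proof -
  have "continuous_on UNIV (\<lambda>(\<phi>, \<theta>). spherical \<phi> \<theta>)"
    unfolding spherical_def vector3_eq case_prod_beta by (intro continuous_intros)
  then show ?thesis
    by (auto intro!: measurable_restrict_space2 borel_measurable_continuous_onI)
qed

lemma emeasure_sphere_measure_S2: "emeasure sphere_measure S2 = 1"
proof -
  let ?R = "{0..pi} \<times> {0..2 * pi}"
  have [measurable]: "?R \<in> sets borel"
    by (intro borel_closed closed_Times) auto
  have dens: "(\<lambda>(\<phi>, \<theta>). ennreal (sin \<phi> / (4 * pi))) \<in> borel_measurable (lborel :: (real \<times> real) measure)"
    unfolding case_prod_beta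
    by (simp, intro measurable_compose[OF _ measurable_ennreal] borel_measurable_continuous_onI
          continuous_intros) auto
  have dens': "(\<lambda>(\<phi>, \<theta>). ennreal (sin \<phi> / (4 * pi))) \<in> borel_measurable (restrict_space lborel ?R)"
    by (rule measurable_restrict_space1[OF dens])
  have map: "(\<lambda>(\<phi>, \<theta>). spherical \<phi> \<theta>) \<in> density (restrict_space lborel ?R)
      (\<lambda>(\<phi>, \<theta>). ennreal (sin \<phi> / (4 * pi))) \<rightarrow>\<^sub>M S2_borel"
    using measurable_restrict_space1[OF spherical_measurable, of ?R]
    by (simp add: measurable_def space_restrict_space sets_restrict_space)
  have S2: "S2 \<in> sets S2_borel"
    using sets.top[of S2_borel] by (simp add: space_restrict_space)
  have "emeasure sphere_measure S2
      = emeasure (density (restrict_space lborel ?R) (\<lambda>(\<phi>, \<theta>). ennreal (sin \<phi> / (4 * pi)))) ?R"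
    unfolding sphere_measure_def emeasure_distr[OF map S2]
    by (rule arg_cong2[of _ _ _ _ emeasure]) (auto simp: space_restrict_space)
  also have "\<dots> = (\<integral>\<^sup>+x. (case x of (\<phi>, \<theta>) \<Rightarrow> ennreal (sin \<phi> / (4 * pi))) * indicator ?R x
                     \<partial>restrict_space lborel ?R)"
    by (rule emeasure_density[OF dens']) (auto simp: sets_restrict_space)
  also have "\<dots> = (\<integral>\<^sup>+x. (case x of (\<phi>, \<theta>) \<Rightarrow> ennreal (sin \<phi> / (4 * pi))) * indicator ?R x \<partial>lborel)"
    by (subst nn_integral_restrict_space) (auto intro!: nn_integral_cong split: split_indicator)
  also have "\<dots> = (\<integral>\<^sup>+x. (case x of (\<phi>, \<theta>) \<Rightarrow> ennreal (sin \<phi> / (4 * pi))) * indicator ?R x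
                     \<partial>(lborel \<Otimes>\<^sub>M lborel))"
    by (simp add: lborel_prod)
  also have "\<dots> = (\<integral>\<^sup>+\<phi>. \<integral>\<^sup>+\<theta>. ennreal (sin \<phi> / (4 * pi)) * indicator ?R (\<phi>, \<theta>) \<partial>lborel \<partial>lborel)"
  proof -
    have "(\<lambda>x. (case x of (\<phi>, \<theta>) \<Rightarrow> ennreal (sin \<phi> / (4 * pi))) * indicator ?R x)
          \<in> borel_measurable (lborel \<Otimes>\<^sub>M lborel)"
      unfolding lborel_prod using dens by measurable
    from lborel.nn_integral_fst[OF this] show ?thesis by simp
  qed
  also have "\<dots> = (\<integral>\<^sup>+\<phi>. ennreal (sin \<phi> / 2) * indicator {0..pi} \<phi> \<partial>lborel)"
  proof (rule nn_integral_cong)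
    fix \<phi> :: real
    have "(\<integral>\<^sup>+\<theta>. ennreal (sin \<phi> / (4 * pi)) * indicator ?R (\<phi>, \<theta>) \<partial>lborel)
        = (\<integral>\<^sup>+\<theta>. (ennreal (sin \<phi> / (4 * pi)) * indicator {0..pi} \<phi>) * indicator {0..2 * pi} \<theta> \<partial>lborel)"
      by (rule nn_integral_cong) (auto split: split_indicator)
    also have "\<dots> = (ennreal (sin \<phi> / (4 * pi)) * indicator {0..pi} \<phi>) * ennreal (2 * pi)"
      by (subst nn_integral_cmult_indicator) auto
    also have "\<dots> = ennreal (sin \<phi> / 2) * indicator {0..pi} \<phi>"
      by (auto split: split_indicator simp: ennreal_mult'[symmetric] ennreal_mult''[symmetric])
    finally show "(\<integral>\<^sup>+\<theta>. ennreal (sin \<phi> / (4 * pi)) * indicator ?R (\<phi>, \<theta>) \<partial>lborel)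
        = ennreal (sin \<phi> / 2) * indicator {0..pi} \<phi>" .
  qed
  also have "\<dots> = ennreal (- cos pi / 2 - (- cos 0 / 2))"
    by (rule nn_integral_FTC_Icc) (auto intro!: derivative_eq_intros sin_ge_zero)
  also have "\<dots> = 1" by simp
  finally show ?thesis .
qed

lemma measure_normalized_counting_measure:
  assumes "finite \<omega>" "\<omega> \<subseteq> S2" "A \<in> sets S2_borel"
  shows "measure (normalized_counting_measure \<omega>) A = real (card (A \<inter> \<omega>)) / real (card \<omega>)"
proof -
  have "A \<subseteq> S2" using sets.sets_into_space[OF assms(3)] by (simp add: space_restrict_space)
  have "(\<lambda>x. x) \<in> uniform_count_measure \<omega> \<rightarrow>\<^sub>M S2_borel"
    using assms(2) by (auto simp: measurable_def space_restrict_space sets_uniform_count_measure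
      space_uniform_count_measure)
  then show ?thesis
    using assms by (simp add: normalized_counting_measure_def measure_distr
       space_uniform_count_measure measure_uniform_count_measure Int_commute)
qed

end

theory Submission
  imports Defs "HOL-Probability.Probability_Measure"
begin

text \<open>
  Number the rings from north to south by \<open>i = 1, \<dots>, 4k - 1\<close>, ring \<open>i\<close> having
  \<open>n\<^sub>i = 4 min(i, k, 4k - i)\<close> points at height \<open>z\<^sub>i\<close>.  The zones
  \<open>\<bar>z - z\<^sub>i\<bar> \<le> n\<^sub>i / (12k\<^sup>2)\<close> tile \<open>[-1, 1]\<close>, so cutting zone \<open>i\<close> into \<open>n\<^sub>i\<close> equal
  longitude intervals partitions the sphere into \<open>12k\<^sup>2\<close> cells of equal area, each containing
  exactly one point.  The radius of ring \<open>i\<close> lies between \<open>n\<^sub>i / (8k)\<close> and \<open>n\<^sub>i / (4k)\<close>, hence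
  every point of a cell is within \<open>4 / k\<close> of its HEALPix point.  This bounds the covering radius,
  and by uniform continuity also the quadrature error.  Distinct points are at least \<open>1 / (2k)\<close>
  apart: on one ring by the radius bound, on different rings by comparing heights or, within a polar
  cap, distances to the pole.
\<close>

section \<open>Rings\<close>

definition ring_size :: "nat \<Rightarrow> nat \<Rightarrow> nat" where
  "ring_size k i = 4 * min i (min k (4 * k - i))"

text \<open>The branches are the north cap, the equatorial belt and the mirrored cap. Neighbouring
  formulas agree at \<open>i = k\<close> and \<open>i = 3 * k\<close>, and the values at
  \<open>i = 0\<close> and \<open>i = 4 * k\<close> are the heights of the poles.\<close>

definition ring_height :: "nat \<Rightarrow> nat \<Rightarrow> real" where
  "ring_height k i =
     (if i \<le> k then 1 - (real i / real k)\<^sup>2 / 3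
      else if i < 3 * k then 4 / 3 - 2 / 3 * (real i / real k)
      else (4 - real i / real k)\<^sup>2 / 3 - 1)"

text \<open>A cap above height z has normalized area (1 - z) / 2. Hence the cap above this boundary
  has as its share of the area the share of the 12k^2 points that lie on rings 1 to
  \<open>i\<close>.\<close>

definition ring_boundary :: "nat \<Rightarrow> nat \<Rightarrow> real" where
  "ring_boundary k i = 1 - (\<Sum>m=1..i. real (ring_size k m)) / (6 * (real k)\<^sup>2)"

lemma ring_height_equatorial:
  assumes "k \<ge> 1" "k \<le> i" "i \<le> 3 * k"
  shows "ring_height k i = 4 / 3 - 2 / 3 * (real i / real k)"
  using assms by (cases "i = k"; cases "i = 3 * k") (auto simp: ring_height_def)

lemma ring_height_south:
  assumes "k \<ge> 1" "3 * k \<le> i"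
  shows "ring_height k i = (4 - real i / real k)\<^sup>2 / 3 - 1"
  using assms by (auto simp: ring_height_def)

lemma ring_height_reflect:
  assumes "k \<ge> 1" "i \<le> 4 * k"
  shows "ring_height k (4 * k - i) = - ring_height k i"
proof -
  have eq: "real (4 * k - i) / real k = 4 - real i / real k"
    using assms by (simp add: of_nat_diff field_simps)
  consider "i \<le> k" | "k \<le> i" "i \<le> 3 * k" | "3 * k \<le> i" by linarith
  then show ?thesis
  proof cases
    case 1
    then show ?thesis using assms
      by (subst ring_height_south) (simp_all add: eq ring_height_def del: of_nat_diff of_nat_mult)
  next
    case 2
    then show ?thesis using assms
      by (subst (1 2) ring_height_equatorial)
        (simp_all add: eq del: of_nat_diff of_nat_mult, simp add: field_simps)
  next
    case 3
    then have "4 * k - i \<le> k" by simp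
    with 3 show ?thesis using assms
      by (subst (2) ring_height_south)
        (simp_all add: ring_height_def[of k "4 * k - i"] eq del: of_nat_diff of_nat_mult)
  qed
qed

section \<open>Zones between consecutive ring boundaries\<close>

lemma ring_size_le: "ring_size k i \<le> 4 * k"
  by (simp add: ring_size_def)

lemma ring_size_reflect: "i \<le> 4 * k \<Longrightarrow> ring_size k (4 * k - i) = ring_size k i"
  by (auto simp: ring_size_def min_def)

lemma ring_boundary_Suc:
  "ring_boundary k (Suc i) = ring_boundary k i - real (ring_size k (Suc i)) / (6 * (real k)\<^sup>2)"
  by (simp add: ring_boundary_def add_divide_distrib)

lemma ring_boundary_antimono: "i \<le> j \<Longrightarrow> ring_boundary k j \<le> ring_boundary k i"
  by (rule lift_Suc_antimono_le[of "ring_boundary k"]) (simp_all add: ring_boundary_Suc)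

text \<open>Neighbouring zones meet because consecutive heights differ by (n_i + n_(i+1)) / (12k^2):
  in a cap this is a difference of consecutive squares over 3k^2, in the belt the constant 2 /
  (3k).\<close>

lemma ring_height_step:
  assumes "k \<ge> 1" "i < 4 * k"
  shows "ring_height k (Suc i) + real (ring_size k (Suc i)) / (12 * (real k)\<^sup>2)
       = ring_height k i - real (ring_size k i) / (12 * (real k)\<^sup>2)"
proof -
  have k: "real k > 0" using assms by simp
  consider "i < k" | "k \<le> i" "i < 3 * k" | "3 * k \<le> i" by linarith
  then show ?thesis
  proof cases
    case 1
    then have "ring_size k i = 4 * i" "ring_size k (Suc i) = 4 * Suc i"
      by (auto simp: ring_size_def)
    with 1 k show ?thesis
      by (simp add: ring_height_def field_simps power2_eq_square)
  next
    case 2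
    then have "ring_size k i = 4 * k" "ring_size k (Suc i) = 4 * k"
      by (auto simp: ring_size_def)
    with 2 k assms show ?thesis
      by (simp add: ring_height_equatorial) (simp add: field_simps power2_eq_square)
  next
    case 3
    then have "real (ring_size k i) = 4 * (4 * real k - real i)"
        "real (ring_size k (Suc i)) = 4 * (4 * real k - real i - 1)"
      using assms by (auto simp: ring_size_def of_nat_diff min_def)
    with 3 k assms show ?thesis
      by (simp add: ring_height_south) (simp add: field_simps power2_eq_square)
  qed
qed

text \<open>By \<open>ring_height_step\<close> the right side drops by n_(i+1) / (6k^2) per step,
  exactly as \<open>ring_boundary\<close> does; the induction starts at the empty ring 0, at the
  north pole.\<close>

lemma ring_boundary_lower:
  assumes "k \<ge> 1" "i \<le> 4 * k"
  shows "ring_boundary k i = ring_height k i - real (ring_size k i) / (12 * (real k)\<^sup>2)"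
  using assms(2)
proof (induction i)
  case 0
  then show ?case by (simp add: ring_boundary_def ring_height_def ring_size_def)
next
  case (Suc i)
  then show ?case
    using ring_height_step[OF assms(1), of i] by (simp add: ring_boundary_Suc)
qed

lemma ring_boundary_upper:
  assumes "k \<ge> 1" "1 \<le> i" "i \<le> 4 * k"
  shows "ring_boundary k (i - 1) = ring_height k i + real (ring_size k i) / (12 * (real k)\<^sup>2)"
  using ring_boundary_lower[of k "i - 1"] ring_height_step[of k "i - 1"] assms by simp

lemma ring_boundary_0 [simp]: "ring_boundary k 0 = 1"
  by (simp add: ring_boundary_def)

lemma ring_boundary_last: "k \<ge> 1 \<Longrightarrow> ring_boundary k (4 * k) = -1"
  by (simp add: ring_boundary_lower ring_height_south ring_size_def)

lemma ring_boundary_bounds: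
  assumes "k \<ge> 1" "i \<le> 4 * k"
  shows "-1 \<le> ring_boundary k i" "ring_boundary k i \<le> 1"
  using ring_boundary_antimono[of i "4 * k" k] ring_boundary_antimono[of 0 i k]
    ring_boundary_last assms by simp_all

text \<open>No summation by cases is done: the last boundary is -1, so the sum divided by 6k^2 is
  2.\<close>

lemma sum_ring_size:
  assumes "k \<ge> 1"
  shows "(\<Sum>i=1..4 * k. ring_size k i) = 12 * k\<^sup>2"
proof -
  have "(\<Sum>i=1..4 * k. real (ring_size k i)) = 12 * (real k)\<^sup>2"
    using ring_boundary_last[OF assms] assms by (simp add: ring_boundary_def field_simps)
  then have "real (\<Sum>i=1..4 * k. ring_size k i) = real (12 * k\<^sup>2)" by simp
  then show ?thesis by (simp only: of_nat_eq_iff)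
qed

text \<open>The middle term is the squared radius of the ring. In a cap, with t = (i/k)^2, it is t
  (2/3 - t/9), between t/4 and t; in the belt the height is at most 2/3 in absolute value, so it
  lies between 5/9 and 1.\<close>

lemma ring_radius_squared_bounds:
  assumes "k \<ge> 1" "i \<le> 4 * k"
  shows "(real (ring_size k i) / (8 * real k))\<^sup>2 \<le> 1 - (ring_height k i)\<^sup>2"
    and "1 - (ring_height k i)\<^sup>2 \<le> (real (ring_size k i) / (4 * real k))\<^sup>2"
proof -
  have "(real (ring_size k i) / (8 * real k))\<^sup>2 \<le> 1 - (ring_height k i)\<^sup>2 \<and>
        1 - (ring_height k i)\<^sup>2 \<le> (real (ring_size k i) / (4 * real k))\<^sup>2"
    if i: "i \<le> 2 * k" for i
  proof (cases "i \<le> k")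
    case True
    define t where "t = (real i / real k)\<^sup>2"
    have t: "0 \<le> t" "t \<le> 1"
      using True assms by (simp_all add: t_def power_le_one)
    have "ring_size k i = 4 * i" using True by (simp add: ring_size_def)
    then have "(real (ring_size k i) / (8 * real k))\<^sup>2 = t / 4"
        "(real (ring_size k i) / (4 * real k))\<^sup>2 = t"
      by (simp_all add: t_def power_divide power_mult_distrib)
    moreover have "1 - (ring_height k i)\<^sup>2 = t * (2 / 3 - t / 9)"
      using True by (simp add: ring_height_def t_def[symmetric])
        (simp add: power2_eq_square algebra_simps)
    moreover have "t * (1 / 4) \<le> t * (2 / 3 - t / 9)" "t * (2 / 3 - t / 9) \<le> t * 1"
      using t by (intro mult_left_mono; simp)+
    ultimately show ?thesis by (simp only: mult_1_right) simp
  next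
    case False
    define t where "t = 4 / 3 - 2 / 3 * (real i / real k)"
    have "0 \<le> t" "t \<le> 2 / 3"
      using False i assms by (simp_all add: t_def field_simps)
    then have "t\<^sup>2 \<le> (2 / 3)\<^sup>2" by (intro power_mono)
    moreover have "ring_size k i = 4 * k" using False i by (simp add: ring_size_def)
    moreover have "ring_height k i = t"
      using False i assms by (simp add: ring_height_equatorial t_def)
    ultimately show ?thesis
      using assms by (simp add: power_divide)
  qed
  \<comment> \<open>The southern rings inherit the bounds by reflection in the equator.\<close>
  from this[of i] this[of "4 * k - i"]
  have "(real (ring_size k i) / (8 * real k))\<^sup>2 \<le> 1 - (ring_height k i)\<^sup>2 \<and>
        1 - (ring_height k i)\<^sup>2 \<le> (real (ring_size k i) / (4 * real k))\<^sup>2"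
    using assms ring_height_reflect[OF assms]
    by (cases "i \<le> 2 * k") (auto simp: ring_size_reflect)
  then show "(real (ring_size k i) / (8 * real k))\<^sup>2 \<le> 1 - (ring_height k i)\<^sup>2"
    "1 - (ring_height k i)\<^sup>2 \<le> (real (ring_size k i) / (4 * real k))\<^sup>2" by auto
qed

lemma abs_ring_height_le_1:
  assumes "k \<ge> 1" "i \<le> 4 * k"
  shows "\<bar>ring_height k i\<bar> \<le> 1"
  using order.trans[OF zero_le_power2 ring_radius_squared_bounds(1)[OF assms]]
  by (simp add: abs_square_le_1)

section \<open>Colatitudes and radii of the rings\<close>

definition ring_colatitude :: "nat \<Rightarrow> nat \<Rightarrow> real" where
  "ring_colatitude k i = arccos (ring_height k i)"

lemma cos_ring_colatitude:
  assumes "k \<ge> 1" "i \<le> 4 * k"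
  shows "cos (ring_colatitude k i) = ring_height k i"
  using abs_ring_height_le_1[OF assms] by (simp add: ring_colatitude_def cos_arccos_abs)

lemma ring_colatitude_bounds:
  assumes "k \<ge> 1" "i \<le> 4 * k"
  shows "0 \<le> ring_colatitude k i" "ring_colatitude k i \<le> pi"
  using abs_ring_height_le_1[OF assms]
  by (auto simp: ring_colatitude_def abs_le_iff intro!: arccos_lbound arccos_ubound)

lemma sin_ring_colatitude_bounds:
  assumes "k \<ge> 1" "i \<le> 4 * k"
  shows "real (ring_size k i) / (8 * real k) \<le> sin (ring_colatitude k i)"
    and "sin (ring_colatitude k i) \<le> real (ring_size k i) / (4 * real k)"
proof -
  have pos: "0 \<le> sin (ring_colatitude k i)"
    using ring_colatitude_bounds[OF assms] by (rule sin_ge_zero)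
  have sq: "(sin (ring_colatitude k i))\<^sup>2 = 1 - (ring_height k i)\<^sup>2"
    by (simp add: sin_squared_eq cos_ring_colatitude[OF assms])
  show "real (ring_size k i) / (8 * real k) \<le> sin (ring_colatitude k i)"
    using ring_radius_squared_bounds(1)[OF assms] pos unfolding sq[symmetric]
    by (rule power2_le_imp_le)
  show "sin (ring_colatitude k i) \<le> real (ring_size k i) / (4 * real k)"
    using ring_radius_squared_bounds(2)[OF assms] unfolding sq[symmetric]
    by (rule power2_le_imp_le) simp
qed

section \<open>Points\<close>

text \<open>The value 1 encodes the half step of the polar rings. The parity formula also yields 1
  at \<open>i = k\<close> and \<open>i = 3 * k\<close>.\<close>

definition ring_shift :: "nat \<Rightarrow> nat \<Rightarrow> nat" where
  "ring_shift k i = (if k < i \<and> i < 3 * k then (i - k + 1) mod 2 else 1)"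

definition ring_longitude :: "nat \<Rightarrow> nat \<Rightarrow> nat \<Rightarrow> real" where
  "ring_longitude k i j = 2 * pi / real (ring_size k i) * (real j - real (ring_shift k i) / 2)"

definition healpix_point :: "nat \<Rightarrow> nat \<times> nat \<Rightarrow> real ^ 3" where
  "healpix_point k = (\<lambda>(i, j). spherical (ring_colatitude k i) (ring_longitude k i j))"

text \<open>Ring \<open>4 * k\<close> is empty; including it lets the zone boundaries run from \<open>1\<close> to \<open>-1\<close>.\<close>

definition healpix_index :: "nat \<Rightarrow> (nat \<times> nat) set" where
  "healpix_index k = (SIGMA i:{1..4 * k}. {1..ring_size k i})"

lemma finite_healpix_index [simp]: "finite (healpix_index k)"
  by (simp add: healpix_index_def)

lemma card_healpix_index: "k \<ge> 1 \<Longrightarrow> card (healpix_index k) = 12 * k\<^sup>2"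
  unfolding healpix_index_def by (simp add: sum_ring_size del: One_nat_def)

lemma ring_shift_le_1: "ring_shift k i \<le> 1"
  by (auto simp: ring_shift_def)

text \<open>The offsets from \<open>k\<close> of a belt ring and its mirror image add up to 2k, so
  they have the same parity. Thus both signs in the original description share one longitude
  formula.\<close>

lemma ring_shift_reflect:
  assumes "i \<le> 4 * k"
  shows "ring_shift k (4 * k - i) = ring_shift k i"
proof (cases "k < i \<and> i < 3 * k")
  case True
  have "(4 * k - i - k) + (i - k) = 2 * k" using True by simp
  moreover have "(a + 1) mod 2 = (b + 1) mod 2" if "a + b = 2 * k" for a b :: nat
    using that by presburger
  ultimately have "(4 * k - i - k + 1) mod 2 = (i - k + 1) mod 2" by blast
  with True show ?thesis by (auto simp: ring_shift_def)
next
  case False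
  with assms show ?thesis by (auto simp: ring_shift_def)
qed

section \<open>Identification of the indexed points with the configuration\<close>

lemma eq_ring_colatitude_iff:
  assumes "k \<ge> 1" "i \<le> 4 * k"
  shows "0 \<le> \<phi> \<and> \<phi> \<le> pi \<and> cos \<phi> = ring_height k i \<longleftrightarrow> \<phi> = ring_colatitude k i"
proof
  assume "0 \<le> \<phi> \<and> \<phi> \<le> pi \<and> cos \<phi> = ring_height k i"
  then show "\<phi> = ring_colatitude k i"
    using arccos_cos[of \<phi>] by (simp add: ring_colatitude_def)
next
  assume "\<phi> = ring_colatitude k i"
  then show "0 \<le> \<phi> \<and> \<phi> \<le> pi \<and> cos \<phi> = ring_height k i"
    using ring_colatitude_bounds[OF assms] cos_ring_colatitude[OF assms] by simp
qed

text \<open>Replaces the sign by the mirror index \<open>4 * k - i\<close>, so that each ring is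
  addressed by a single number.\<close>

lemma healpix_polar_iff:
  assumes "k \<ge> 1"
  shows "x \<in> healpix_polar k \<longleftrightarrow>
    (\<exists>i\<in>{1..k}. \<exists>j\<in>{1..4 * i}. x = healpix_point k (i, j) \<or> x = healpix_point k (4 * k - i, j))"
proof -
  have "0 \<le> \<phi> \<and> \<phi> \<le> pi \<and> cos \<phi> = 1 - (real i)\<^sup>2 / (3 * (real k)\<^sup>2) \<longleftrightarrow> \<phi> = ring_colatitude k i"
    "0 \<le> \<phi> \<and> \<phi> \<le> pi \<and> cos \<phi> = - (1 - (real i)\<^sup>2 / (3 * (real k)\<^sup>2)) \<longleftrightarrow>
       \<phi> = ring_colatitude k (4 * k - i)"
    "pi / (2 * real i) * (real j - 1 / 2) = ring_longitude k i j"
    "pi / (2 * real i) * (real j - 1 / 2) = ring_longitude k (4 * k - i) j"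
    if i: "i \<in> {1..k}" for i j \<phi>
  proof -
    have h: "1 - (real i)\<^sup>2 / (3 * (real k)\<^sup>2) = ring_height k i"
      using i by (simp add: ring_height_def power_divide)
    have i4: "i \<le> 4 * k" using i by simp
    show "0 \<le> \<phi> \<and> \<phi> \<le> pi \<and> cos \<phi> = 1 - (real i)\<^sup>2 / (3 * (real k)\<^sup>2) \<longleftrightarrow> \<phi> = ring_colatitude k i"
      unfolding h by (rule eq_ring_colatitude_iff[OF assms i4])
    show "0 \<le> \<phi> \<and> \<phi> \<le> pi \<and> cos \<phi> = - (1 - (real i)\<^sup>2 / (3 * (real k)\<^sup>2)) \<longleftrightarrow>
       \<phi> = ring_colatitude k (4 * k - i)"
      unfolding h ring_height_reflect[OF assms i4, symmetric]
      by (rule eq_ring_colatitude_iff[OF assms]) simp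
    have "ring_size k i = 4 * i" "ring_shift k i = 1"
      using i by (auto simp: ring_size_def ring_shift_def)
    then show l: "pi / (2 * real i) * (real j - 1 / 2) = ring_longitude k i j"
      by (simp add: ring_longitude_def)
    show "pi / (2 * real i) * (real j - 1 / 2) = ring_longitude k (4 * k - i) j"
      unfolding l using i4 by (simp add: ring_longitude_def ring_size_reflect ring_shift_reflect)
  qed
  note eqs = this
  \<comment> \<open>The sign is expanded into a disjunction and the longitude substituted, which
    leaves only the colatitude to be solved for.\<close>
  have "x \<in> healpix_polar k \<longleftrightarrow> (\<exists>i\<in>{1..k}. \<exists>j\<in>{1..4 * i}. \<exists>\<phi>.
      x = spherical \<phi> (pi / (2 * real i) * (real j - 1 / 2)) \<and>
      ((0 \<le> \<phi> \<and> \<phi> \<le> pi \<and> cos \<phi> = 1 - (real i)\<^sup>2 / (3 * (real k)\<^sup>2)) \<or>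
       (0 \<le> \<phi> \<and> \<phi> \<le> pi \<and> cos \<phi> = - (1 - (real i)\<^sup>2 / (3 * (real k)\<^sup>2)))))"
    unfolding healpix_polar_def by fastforce
  also have "\<dots> \<longleftrightarrow> (\<exists>i\<in>{1..k}. \<exists>j\<in>{1..4 * i}. \<exists>\<phi>.
      x = spherical \<phi> (pi / (2 * real i) * (real j - 1 / 2)) \<and>
      (\<phi> = ring_colatitude k i \<or> \<phi> = ring_colatitude k (4 * k - i)))"
    using eqs(1,2) by (intro bex_cong refl ex_cong) auto
  also have "\<dots> \<longleftrightarrow>
    (\<exists>i\<in>{1..k}. \<exists>j\<in>{1..4 * i}. x = healpix_point k (i, j) \<or> x = healpix_point k (4 * k - i, j))"
    unfolding healpix_point_def prod.case by (intro bex_cong refl) (metis eqs(3,4))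
  finally show ?thesis .
qed

lemma healpix_equatorial_iff:
  assumes "k \<ge> 1"
  shows "x \<in> healpix_equatorial k \<longleftrightarrow>
    (\<exists>i\<in>{k + 1..2 * k}. \<exists>j\<in>{1..4 * k}. x = healpix_point k (i, j) \<or> x = healpix_point k (4 * k - i, j))"
proof -
  have "0 \<le> \<phi> \<and> \<phi> \<le> pi \<and> cos \<phi> = 4 / 3 - 2 * real i / (3 * real k) \<longleftrightarrow> \<phi> = ring_colatitude k i"
    "0 \<le> \<phi> \<and> \<phi> \<le> pi \<and> cos \<phi> = - (4 / 3 - 2 * real i / (3 * real k)) \<longleftrightarrow>
       \<phi> = ring_colatitude k (4 * k - i)"
    "pi / (2 * real k) * (real j - real ((i - k + 1) mod 2) / 2) = ring_longitude k i j"
    "pi / (2 * real k) * (real j - real ((i - k + 1) mod 2) / 2) = ring_longitude k (4 * k - i) j"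
    if i: "i \<in> {k + 1..2 * k}" for i j \<phi>
  proof -
    have h: "4 / 3 - 2 * real i / (3 * real k) = ring_height k i"
      using i assms by (simp add: ring_height_equatorial)
    have i4: "i \<le> 4 * k" using i by simp
    show "0 \<le> \<phi> \<and> \<phi> \<le> pi \<and> cos \<phi> = 4 / 3 - 2 * real i / (3 * real k) \<longleftrightarrow> \<phi> = ring_colatitude k i"
      unfolding h by (rule eq_ring_colatitude_iff[OF assms i4])
    show "0 \<le> \<phi> \<and> \<phi> \<le> pi \<and> cos \<phi> = - (4 / 3 - 2 * real i / (3 * real k)) \<longleftrightarrow>
       \<phi> = ring_colatitude k (4 * k - i)"
      unfolding h ring_height_reflect[OF assms i4, symmetric]
      by (rule eq_ring_colatitude_iff[OF assms]) simp
    have "ring_size k i = 4 * k" "ring_shift k i = (i - k + 1) mod 2"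
      using i by (auto simp: ring_size_def ring_shift_def)
    then show l: "pi / (2 * real k) * (real j - real ((i - k + 1) mod 2) / 2) = ring_longitude k i j"
      by (simp add: ring_longitude_def)
    show "pi / (2 * real k) * (real j - real ((i - k + 1) mod 2) / 2) = ring_longitude k (4 * k - i) j"
      unfolding l using i4 by (simp add: ring_longitude_def ring_size_reflect ring_shift_reflect)
  qed
  note eqs = this
  have "x \<in> healpix_equatorial k \<longleftrightarrow> (\<exists>i\<in>{k + 1..2 * k}. \<exists>j\<in>{1..4 * k}. \<exists>\<phi>.
      x = spherical \<phi> (pi / (2 * real k) * (real j - real ((i - k + 1) mod 2) / 2)) \<and>
      ((0 \<le> \<phi> \<and> \<phi> \<le> pi \<and> cos \<phi> = 4 / 3 - 2 * real i / (3 * real k)) \<or>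
       (0 \<le> \<phi> \<and> \<phi> \<le> pi \<and> cos \<phi> = - (4 / 3 - 2 * real i / (3 * real k)))))"
    unfolding healpix_equatorial_def by fastforce
  also have "\<dots> \<longleftrightarrow> (\<exists>i\<in>{k + 1..2 * k}. \<exists>j\<in>{1..4 * k}. \<exists>\<phi>.
      x = spherical \<phi> (pi / (2 * real k) * (real j - real ((i - k + 1) mod 2) / 2)) \<and>
      (\<phi> = ring_colatitude k i \<or> \<phi> = ring_colatitude k (4 * k - i)))"
    using eqs(1,2) by (intro bex_cong refl ex_cong) auto
  also have "\<dots> \<longleftrightarrow>
    (\<exists>i\<in>{k + 1..2 * k}. \<exists>j\<in>{1..4 * k}. x = healpix_point k (i, j) \<or> x = healpix_point k (4 * k - i, j))"
    unfolding healpix_point_def prod.case by (intro bex_cong refl) (metis eqs(3,4))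
  finally show ?thesis .
qed

text \<open>At \<open>i = 2 * k\<close> both signs lead to the same index, so the equator is counted
  once.\<close>

lemma healpix_eq_image:
  assumes "k \<ge> 1"
  shows "healpix k = healpix_point k ` healpix_index k"
proof (rule equalityI; rule subsetI)
  fix x assume "x \<in> healpix k"
  then consider i j where "i \<in> {1..k}" "j \<in> {1..4 * i}"
      "x = healpix_point k (i, j) \<or> x = healpix_point k (4 * k - i, j)"
    | i j where "i \<in> {k + 1..2 * k}" "j \<in> {1..4 * k}"
      "x = healpix_point k (i, j) \<or> x = healpix_point k (4 * k - i, j)"
    unfolding healpix_def Un_iff healpix_polar_iff[OF assms]
      healpix_equatorial_iff[OF assms] by blast
  then show "x \<in> healpix_point k ` healpix_index k"
  proof cases
    case 1
    then have "(i, j) \<in> healpix_index k" "(4 * k - i, j) \<in> healpix_index k"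
      by (auto simp: healpix_index_def ring_size_def)
    with 1 show ?thesis by blast
  next
    case 2
    then have "(i, j) \<in> healpix_index k" "(4 * k - i, j) \<in> healpix_index k"
      by (auto simp: healpix_index_def ring_size_def)
    with 2 show ?thesis by blast
  qed
next
  fix x assume "x \<in> healpix_point k ` healpix_index k"
  then obtain i j where ij: "1 \<le> i" "i \<le> 4 * k" "1 \<le> j" "j \<le> ring_size k i"
      and x: "x = healpix_point k (i, j)"
    by (auto simp: healpix_index_def)
  \<comment> \<open>Rings south of the equator are found in the original description under the
    witness \<open>4 * k - i\<close>.\<close>
  have refl: "4 * k - (4 * k - i) = i" using ij by simp
  consider "i \<le> k" | "k < i" "i \<le> 2 * k" | "2 * k < i" "i < 3 * k" | "3 * k \<le> i" by linarith
  then show "x \<in> healpix k"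
  proof cases
    case 1
    with ij have "i \<in> {1..k}" "j \<in> {1..4 * i}" by (auto simp: ring_size_def)
    with x show ?thesis
      unfolding healpix_def Un_iff healpix_polar_iff[OF assms] by blast
  next
    case 2
    with ij have "i \<in> {k + 1..2 * k}" "j \<in> {1..4 * k}" by (auto simp: ring_size_def)
    with x show ?thesis
      unfolding healpix_def Un_iff healpix_equatorial_iff[OF assms] by blast
  next
    case 3
    with ij have "4 * k - i \<in> {k + 1..2 * k}" "j \<in> {1..4 * k}" by (auto simp: ring_size_def)
    with x refl show ?thesis
      unfolding healpix_def Un_iff healpix_equatorial_iff[OF assms] by metis
  next
    case 4
    with ij have "4 * k - i \<in> {1..k}" "j \<in> {1..4 * (4 * k - i)}" by (auto simp: ring_size_def)
    with x refl show ?thesis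
      unfolding healpix_def Un_iff healpix_polar_iff[OF assms] by metis
  qed
qed

section \<open>Separation\<close>

lemma norm_spherical_diff_squared:
  "(norm (spherical a s - spherical b t))\<^sup>2 = 2 - 2 * (sin a * sin b * cos (s - t) + cos a * cos b)"
proof -
  have "spherical a s \<bullet> spherical b t = sin a * sin b * cos (s - t) + cos a * cos b"
    unfolding cos_diff
    by (simp only: spherical_def inner_vec_def sum_3 vector_3 inner_real_def) algebra
  moreover have "spherical a s \<bullet> spherical a s = 1" "spherical b t \<bullet> spherical b t = 1"
    by (simp_all add: power2_norm_eq_inner[symmetric])
  ultimately show ?thesis
    by (simp add: power2_norm_eq_inner inner_diff inner_commute)
qed

text \<open>Both points lie on a circle whose radius is the absolute value of \<open>sin a\<close>;
  this is its chord formula.\<close>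

lemma norm_spherical_diff_longitude:
  "norm (spherical a s - spherical a t) = 2 * \<bar>sin a\<bar> * \<bar>sin ((s - t) / 2)\<bar>"
proof -
  have half: "s - t = 2 * ((s - t) / 2)" by (simp add: field_simps)
  have "cos (s - t) = 1 - 2 * (sin ((s - t) / 2))\<^sup>2"
    by (subst half) (rule cos_double_sin)
  then have "(norm (spherical a s - spherical a t))\<^sup>2
      = 2 - 2 * ((sin a)\<^sup>2 * (1 - 2 * (sin ((s - t) / 2))\<^sup>2) + (cos a)\<^sup>2)"
    unfolding norm_spherical_diff_squared by (simp add: power2_eq_square)
  also have "\<dots> = (2 * \<bar>sin a\<bar> * \<bar>sin ((s - t) / 2)\<bar>)\<^sup>2"
    unfolding cos_squared_eq by (simp add: power_mult_distrib algebra_simps)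
  finally show ?thesis by simp
qed

lemma norm_spherical_diff_height: "\<bar>cos a - cos b\<bar> \<le> norm (spherical a s - spherical b t)"
  using component_le_norm_cart[of "spherical a s - spherical b t" 3]
  by (simp add: spherical_def)

text \<open>By concavity the sine on [0, pi/2] lies above its chord from (0, 0) to (pi/2,
  1).\<close>

lemma jordan_sin_ge:
  assumes "0 \<le> x" "x \<le> 1"
  shows "x \<le> sin (pi / 2 * x)"
proof -
  have "concave_on {0..pi / 2} sin"
    by (rule f''_le0_imp_concave[where f' = cos and f'' = "\<lambda>x. - sin x"])
       (auto intro!: derivative_eq_intros sin_ge_zero)
  from concave_onD[OF this assms, of 0 "pi / 2"] show ?thesis
    by (simp add: mult.commute)
qed

text \<open>For m at most n/2 the Jordan inequality gives 2m/n; larger m reduce to n - m by sin (pi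
  - x) = sin x.\<close>

lemma abs_sin_pi_frac_ge:
  assumes "1 \<le> m" "m < n"
  shows "2 / real n \<le> \<bar>sin (pi * real m / real n)\<bar>"
proof -
  have main: "2 / real n \<le> sin (pi * real m / real n)" if "1 \<le> m" "2 * m \<le> n" for m
  proof -
    have "2 / real n \<le> 2 * real m / real n" using that by (intro divide_right_mono) auto
    also have "\<dots> \<le> sin (pi / 2 * (2 * real m / real n))"
      using that by (intro jordan_sin_ge) (auto simp: divide_simps)
    finally show ?thesis by simp
  qed
  show ?thesis
  proof (cases "2 * m \<le> n")
    case True
    then show ?thesis using main[of m] assms by linarith
  next
    case False
    have "pi * real (n - m) / real n = pi - pi * real m / real n"
      using assms by (simp add: of_nat_diff field_simps)
    then have "sin (pi * real (n - m) / real n) = sin (pi * real m / real n)"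
      by simp
    moreover have "1 \<le> n - m" "2 * (n - m) \<le> n" using assms False by auto
    ultimately show ?thesis using main[of "n - m"] by simp
  qed
qed

text \<open>The chord is at least 2 * n/(8k) * 2/n; the number n of points on the ring cancels,
  which makes the bound uniform up to the poles.\<close>

lemma healpix_point_separated_ring:
  assumes "k \<ge> 1" "(i, j) \<in> healpix_index k" "(i, j') \<in> healpix_index k" "j < j'"
  shows "1 / (2 * real k) \<le> norm (healpix_point k (i, j) - healpix_point k (i, j'))"
proof -
  define n where "n = ring_size k i"
  have i: "i \<le> 4 * k" and j: "1 \<le> j" "j' \<le> n" using assms by (auto simp: healpix_index_def n_def)
  then have n: "real n > 0" using assms(4) by simp
  have "(ring_longitude k i j - ring_longitude k i j') / 2 = - (pi * real (j' - j) / real n)"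
    using n assms(4) by (simp add: ring_longitude_def n_def[symmetric] of_nat_diff field_simps)
  then have "\<bar>sin ((ring_longitude k i j - ring_longitude k i j') / 2)\<bar>
      = \<bar>sin (pi * real (j' - j) / real n)\<bar>" by simp
  also have "\<dots> \<ge> 2 / real n" using assms j by (intro abs_sin_pi_frac_ge) auto
  finally have s: "2 / real n \<le> \<bar>sin ((ring_longitude k i j - ring_longitude k i j') / 2)\<bar>" .
  have "real n / (8 * real k) \<le> \<bar>sin (ring_colatitude k i)\<bar>"
    using sin_ring_colatitude_bounds(1)[OF assms(1) i] by (simp add: n_def)
  with s have "real n / (8 * real k) * (2 / real n) \<le>
      \<bar>sin (ring_colatitude k i)\<bar> * \<bar>sin ((ring_longitude k i j - ring_longitude k i j') / 2)\<bar>"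
    by (intro mult_mono) auto
  then show ?thesis
    using n by (simp add: healpix_point_def norm_spherical_diff_longitude)
qed

text \<open>The squared distance to the pole is 2 - 2z with z the absolute height, that is 2/3
  (i/k)^2. So the distance is linear in \<open>i\<close>, whereas heights near the pole differ only
  by order 1/k^2 and could not separate the rings.\<close>

lemma norm_healpix_point_pole:
  assumes "k \<ge> 1" "i \<le> k"
  shows "norm (healpix_point k (i, j) - spherical 0 0) = sqrt (2 / 3) * (real i / real k)"
    and "norm (healpix_point k (4 * k - i, j) - spherical pi 0) = sqrt (2 / 3) * (real i / real k)"
proof -
  have h: "ring_height k i = 1 - (real i / real k)\<^sup>2 / 3"
    using assms by (simp add: ring_height_def)
  have c: "cos (ring_colatitude k i) = ring_height k i"
    "cos (ring_colatitude k (4 * k - i)) = - ring_height k i"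
    using assms by (simp_all add: cos_ring_colatitude ring_height_reflect)
  have "(norm (healpix_point k (i, j) - spherical 0 0))\<^sup>2 = (sqrt (2 / 3) * (real i / real k))\<^sup>2"
    unfolding healpix_point_def prod.case norm_spherical_diff_squared c h power_mult_distrib
    by (simp add: power_divide)
  then show "norm (healpix_point k (i, j) - spherical 0 0) = sqrt (2 / 3) * (real i / real k)"
    by (rule power2_eq_imp_eq) auto
  have "(norm (healpix_point k (4 * k - i, j) - spherical pi 0))\<^sup>2 = (sqrt (2 / 3) * (real i / real k))\<^sup>2"
    unfolding healpix_point_def prod.case norm_spherical_diff_squared c h power_mult_distrib
    by (simp add: power_divide)
  then show "norm (healpix_point k (4 * k - i, j) - spherical pi 0) = sqrt (2 / 3) * (real i / real k)"
    by (rule power2_eq_imp_eq) auto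
qed

text \<open>Two rings that do not lie in the same cap are separated by at least one step of the
  belt, which has height 2 / (3k). Clamping both indices to the range from \<open>k\<close> to
  \<open>3 * k\<close> only shrinks the gap.\<close>

lemma ring_height_gap:
  assumes "k \<ge> 1" "i < i'" "i' \<le> 4 * k" "k < i'" "i < 3 * k"
  shows "2 / (3 * real k) \<le> ring_height k i - ring_height k i'"
proof -
  have k: "real k > 0" using assms by simp
  have a: "ring_height k (max i k) \<le> ring_height k i"
  proof (cases "i \<le> k")
    case True
    then have "(real i / real k)\<^sup>2 \<le> 1" using k by (simp add: power_le_one)
    with True k show ?thesis by (simp add: ring_height_def max_def)
  qed (simp add: max_def)
  have b: "ring_height k i' \<le> ring_height k (min i' (3 * k))"
  proof (cases "i' \<le> 3 * k")
    case False
    then have "4 - real i' / real k \<le> 1" "0 \<le> 4 - real i' / real k"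
      using k assms by (simp_all add: field_simps)
    then have "(4 - real i' / real k)\<^sup>2 \<le> 1" by (simp add: power_le_one)
    with False k assms show ?thesis
      by (simp add: ring_height_south min_def)
  qed (simp add: min_def)
  \<comment> \<open>One belt step survives the clamping because \<open>k < i'\<close> and
    \<open>i < 3 * k\<close>.\<close>
  have "real (max i k) + 1 \<le> real (min i' (3 * k))" using assms by auto
  then have "2 / 3 * (1 / real k) \<le> 2 / 3 * (real (min i' (3 * k)) / real k - real (max i k) / real k)"
    using k unfolding diff_divide_distrib[symmetric]
    by (intro mult_left_mono divide_right_mono) auto
  also have "\<dots> = ring_height k (max i k) - ring_height k (min i' (3 * k))"
    using assms by (subst (1 2) ring_height_equatorial) (auto simp: algebra_simps)
  finally show ?thesis using a b by simp
qed

lemma healpix_point_separated_rings: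
  assumes "k \<ge> 1" "(i, j) \<in> healpix_index k" "(i', j') \<in> healpix_index k" "i < i'"
  shows "1 / (2 * real k) \<le> norm (healpix_point k (i, j) - healpix_point k (i', j'))"
proof -
  have k: "real k > 0" using assms by simp
  have i: "i \<le> 4 * k" "i' \<le> 4 * k" using assms by (auto simp: healpix_index_def)
  \<comment> \<open>Within a cap each step changes the distance to the pole by sqrt (2/3) / k, of
    which 1 / (2k) is kept; the triangle inequality turns this into a distance between
    points.\<close>
  have "(1 / 2 :: real) \<le> sqrt (2 / 3)"
    by (rule real_le_rsqrt) (simp add: power2_eq_square)
  then have gap: "1 / (2 * real k) \<le> sqrt (2 / 3) * (real b / real k) - sqrt (2 / 3) * (real a / real k)"
    if "a < b" for a b
  proof -
    have "1 / 2 * (1 / real k) \<le> sqrt (2 / 3) * ((real b - real a) / real k)"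
      using that k \<open>1 / 2 \<le> sqrt (2 / 3)\<close>
      by (intro mult_mono divide_right_mono) auto
    then show ?thesis by (simp add: right_diff_distrib diff_divide_distrib)
  qed
  consider "i' \<le> k" | "3 * k \<le> i" | "k < i'" "i < 3 * k" by linarith
  then show ?thesis
  proof cases
    case 1
    have "norm (healpix_point k (i', j') - spherical 0 0) - norm (healpix_point k (i, j) - spherical 0 0)
        \<le> norm (healpix_point k (i, j) - healpix_point k (i', j'))"
      by norm
    with gap[OF assms(4)] 1 assms show ?thesis
      by (simp add: norm_healpix_point_pole)
  next
    case 3
    have "2 / (3 * real k) \<le> \<bar>cos (ring_colatitude k i) - cos (ring_colatitude k i')\<bar>"
      using ring_height_gap[OF assms(1,4) i(2) 3] i assms(1) by (simp add: cos_ring_colatitude)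
    also have "\<dots> \<le> norm (healpix_point k (i, j) - healpix_point k (i', j'))"
      unfolding healpix_point_def prod.case by (rule norm_spherical_diff_height)
    finally show ?thesis using k by (simp add: field_simps)
  next
    case 2
    \<comment> \<open>The indices are written as double reflections to match the south pole formula.
      The roles are swapped: ring \<open>i\<close> is now the one farther from the pole.\<close>
    have "norm (healpix_point k (4 * k - (4 * k - i), j) - spherical pi 0)
        - norm (healpix_point k (4 * k - (4 * k - i'), j') - spherical pi 0)
        \<le> norm (healpix_point k (4 * k - (4 * k - i), j) - healpix_point k (4 * k - (4 * k - i'), j'))"
      by norm
    moreover have "4 * k - i \<le> k" "4 * k - i' \<le> k" using 2 assms by auto
    note norm_healpix_point_pole(2)[OF assms(1) this(1)] norm_healpix_point_pole(2)[OF assms(1) this(2)]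
    moreover have "1 / (2 * real k) \<le> sqrt (2 / 3) * (real (4 * k - i) / real k) -
        sqrt (2 / 3) * (real (4 * k - i') / real k)"
      using assms(4) i by (intro gap) auto
    moreover have "4 * k - (4 * k - i) = i" "4 * k - (4 * k - i') = i'" using i by auto
    ultimately show ?thesis by simp
  qed
qed

section \<open>Separation and cardinality of the whole configuration\<close>

lemma healpix_point_separated:
  assumes "k \<ge> 1" "p \<in> healpix_index k" "q \<in> healpix_index k" "p \<noteq> q"
  shows "1 / (2 * real k) \<le> norm (healpix_point k p - healpix_point k q)"
proof -
  obtain i j i' j' where pq: "p = (i, j)" "q = (i', j')" by (metis surj_pair)
  consider "i < i'" | "i' < i" | "i = i'" "j < j'" | "i = i'" "j' < j"
    using assms(4) pq by fastforce
  then show ?thesis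
    using assms healpix_point_separated_rings[of k i j i' j'] healpix_point_separated_rings[of k i' j' i j]
      healpix_point_separated_ring[of k i j j'] healpix_point_separated_ring[of k i j' j]
    unfolding pq by cases (auto simp: norm_minus_commute)
qed

text \<open>Different indices have points at positive distance; hence the number of points equals
  the number of indices.\<close>

lemma inj_on_healpix_point: "k \<ge> 1 \<Longrightarrow> inj_on (healpix_point k) (healpix_index k)"
  by (rule inj_onI) (use healpix_point_separated in fastforce)

lemma finite_healpix: "k \<ge> 1 \<Longrightarrow> finite (healpix k)"
  by (simp add: healpix_eq_image)

lemma card_healpix: "k \<ge> 1 \<Longrightarrow> card (healpix k) = 12 * k\<^sup>2"
  by (simp add: healpix_eq_image card_image inj_on_healpix_point card_healpix_index)

lemma healpix_subset_S2: "k \<ge> 1 \<Longrightarrow> healpix k \<subseteq> S2"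
  by (auto simp: healpix_eq_image healpix_point_def)

lemma separation_healpix_ge:
  assumes "k \<ge> 1"
  shows "1 / (2 * real k) \<le> separation (healpix k)"
proof -
  let ?D = "{norm (x - y) | x y. x \<in> healpix k \<and> y \<in> healpix k \<and> x \<noteq> y}"
  have "?D \<subseteq> (\<lambda>(x, y). norm (x - y)) ` (healpix k \<times> healpix k)" by auto
  then have fin: "finite ?D"
    by (rule finite_subset) (intro finite_imageI finite_cartesian_product finite_healpix assms)
  \<comment> \<open>At least 12 points exist, so the set under \<open>Min\<close> is
    non-empty.\<close>
  have "12 * 1 \<le> 12 * k\<^sup>2" using assms by (intro mult_left_mono) auto
  then have "\<not> card (healpix k) \<le> Suc 0" by (simp add: card_healpix[OF assms])
  then have "?D \<noteq> {}"
    using card_le_Suc0_iff_eq[OF finite_healpix[OF assms]] by blast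
  moreover have "1 / (2 * real k) \<le> d" if "d \<in> ?D" for d
    using that healpix_point_separated[OF assms]
    by (auto simp: healpix_eq_image[OF assms])
  ultimately show ?thesis
    unfolding separation_def using fin by (subst Min_ge_iff) auto
qed

section \<open>Covering\<close>

text \<open>On a common meridian the squared distance is the sum of the squared differences of
  heights and radii.\<close>

lemma norm_spherical_diff_latitude:
  "norm (spherical a s - spherical b s) \<le> \<bar>cos a - cos b\<bar> + \<bar>sin a - sin b\<bar>"
proof (rule power2_le_imp_le)
  have eq: "2 - 2 * (sin a * sin b * 1 + cos a * cos b) = (cos a - cos b)\<^sup>2 + (sin a - sin b)\<^sup>2"
    by (simp add: power2_diff sin_squared_eq)
  have "(norm (spherical a s - spherical b s))\<^sup>2 = (cos a - cos b)\<^sup>2 + (sin a - sin b)\<^sup>2"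
    using eq by (simp add: norm_spherical_diff_squared)
  also have "\<dots> \<le> (\<bar>cos a - cos b\<bar> + \<bar>sin a - sin b\<bar>)\<^sup>2"
    by (simp add: power2_sum)
  finally show "(norm (spherical a s - spherical b s))\<^sup>2 \<le> (\<bar>cos a - cos b\<bar> + \<bar>sin a - sin b\<bar>)\<^sup>2" .
qed simp

text \<open>Factor sin^2 a - sin^2 b = cos^2 b - cos^2 a on both sides. This bounds the change of
  radius by the change of height at the cost of one factor of the radius.\<close>

lemma abs_sin_diff_le:
  fixes a b :: real
  assumes "0 \<le> sin a"
  shows "\<bar>sin a - sin b\<bar> * sin b \<le> 2 * \<bar>cos a - cos b\<bar>"
proof -
  have "\<bar>sin a - sin b\<bar> * sin b \<le> \<bar>sin a - sin b\<bar> * \<bar>sin a + sin b\<bar>"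
    by (rule mult_left_mono) (use assms in auto)
  also have "\<dots> = \<bar>(sin a)\<^sup>2 - (sin b)\<^sup>2\<bar>"
    by (simp add: abs_mult[symmetric] power2_eq_square algebra_simps)
  also have "\<dots> = \<bar>cos a - cos b\<bar> * \<bar>cos a + cos b\<bar>"
    unfolding sin_squared_eq
    by (simp add: abs_mult[symmetric] power2_eq_square algebra_simps abs_minus_commute)
  also have "\<dots> \<le> \<bar>cos a - cos b\<bar> * 2"
    using cos_le_one[of a] cos_le_one[of b] cos_ge_minus_one[of a] cos_ge_minus_one[of b]
    by (intro mult_left_mono abs_leI) linarith+
  finally show ?thesis by simp
qed

lemma ring_longitude_mem:
  assumes "(i, j) \<in> healpix_index k"
  shows "2 * pi / real (ring_size k i) * (real j - 1) \<le> ring_longitude k i j"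
    and "ring_longitude k i j \<le> 2 * pi / real (ring_size k i) * real j"
  using ring_shift_le_1[of k i] unfolding ring_longitude_def
  by (intro mult_left_mono; simp)+

text \<open>Move first along the meridian to the ring, then along the ring to the point. Each leg
  costs at most 2/k: the meridian leg 1/(3k) + 4/(3k), the ring leg 2 * n/(4k) * pi/n, which is
  pi/(2k).\<close>

lemma norm_healpix_point_cell_le:
  assumes "k \<ge> 1" "(i, j) \<in> healpix_index k" "0 \<le> \<phi>" "\<phi> \<le> pi"
    and \<phi>: "ring_boundary k i \<le> cos \<phi>" "cos \<phi> \<le> ring_boundary k (i - 1)"
    and \<theta>: "2 * pi / real (ring_size k i) * (real j - 1) \<le> \<theta>"
      "\<theta> \<le> 2 * pi / real (ring_size k i) * real j"
  shows "norm (spherical \<phi> \<theta> - healpix_point k (i, j)) \<le> 4 / real k"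
proof -
  define n where "n = real (ring_size k i)"
  define a where "a = ring_colatitude k i"
  define l where "l = ring_longitude k i j"
  have i: "1 \<le> i" "i \<le> 4 * k" and k: "real k > 0" and n: "n > 0"
    using assms(1,2) by (auto simp: healpix_index_def n_def)
  have n4: "n \<le> 4 * real k" using ring_size_le[of k i] by (simp add: n_def)
  have sa: "n / (8 * real k) \<le> sin a" "sin a \<le> n / (4 * real k)"
    using sin_ring_colatitude_bounds[OF assms(1) i(2)] by (auto simp: n_def a_def)
  \<comment> \<open>Both longitudes lie in the same interval of length 2 pi / n.\<close>
  have "\<bar>\<theta> - l\<bar> \<le> 2 * pi / n"
    using \<theta> ring_longitude_mem[OF assms(2)] unfolding n_def[symmetric] l_def[symmetric]
    by (simp add: right_diff_distrib)
  then have "\<bar>sin ((\<theta> - l) / 2)\<bar> \<le> pi / n"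
    using abs_sin_x_le_abs_x[of "(\<theta> - l) / 2"] by simp
  then have "\<bar>sin a\<bar> * \<bar>sin ((\<theta> - l) / 2)\<bar> \<le> n / (4 * real k) * (pi / n)"
    using sa n k by (intro mult_mono) (auto simp: abs_le_iff intro: order_trans[of _ 0])
  then have lon: "norm (spherical a \<theta> - spherical a l) \<le> 2 / real k"
    using n k pi_less_4 by (simp add: norm_spherical_diff_longitude field_simps)
  have c: "\<bar>cos \<phi> - cos a\<bar> \<le> n / (12 * (real k)\<^sup>2)"
    using \<phi> ring_boundary_upper[OF assms(1) i] ring_boundary_lower[OF assms(1) i(2)]
    by (simp add: n_def a_def cos_ring_colatitude[OF assms(1) i(2)] abs_le_iff)
  also have "\<dots> \<le> 4 * real k / (12 * (real k)\<^sup>2)" using n4 by (intro divide_right_mono) auto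
  finally have c': "\<bar>cos \<phi> - cos a\<bar> \<le> 1 / (3 * real k)" using k by (simp add: power2_eq_square)
  \<comment> \<open>The small radius near a pole is compensated by the thin zone there: both are
    proportional to n, which cancels.\<close>
  have "\<bar>sin \<phi> - sin a\<bar> * (n / (8 * real k)) \<le> \<bar>sin \<phi> - sin a\<bar> * sin a"
    using sa by (intro mult_left_mono) auto
  also have "\<dots> \<le> 2 * \<bar>cos \<phi> - cos a\<bar>"
    using assms by (intro abs_sin_diff_le sin_ge_zero)
  also have "\<dots> \<le> 2 * (n / (12 * (real k)\<^sup>2))" using c by simp
  finally have "\<bar>sin \<phi> - sin a\<bar> \<le> 4 / (3 * real k)"
    using n k by (simp add: field_simps power2_eq_square)
  with c' have "\<bar>cos \<phi> - cos a\<bar> + \<bar>sin \<phi> - sin a\<bar> \<le> 1 / (3 * real k) + 4 / (3 * real k)"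
    by (rule add_mono)
  also have "\<dots> \<le> 2 / real k" using k by (simp add: field_simps)
  finally have lat: "norm (spherical \<phi> \<theta> - spherical a \<theta>) \<le> 2 / real k"
    using norm_spherical_diff_latitude[of \<phi> \<theta> a] by linarith
  have "norm (spherical \<phi> \<theta> - spherical a l) \<le> 2 / real k + 2 / real k"
    using norm_diff_triangle_le[OF lat lon] .
  then show ?thesis by (simp add: healpix_point_def a_def l_def)
qed

section \<open>Locating a point of the sphere in a cell\<close>

lemma S2_spherical_coordinates:
  assumes "y \<in> S2"
  obtains \<phi> \<theta> where "y = spherical \<phi> \<theta>" "0 \<le> \<phi>" "\<phi> \<le> pi" "0 \<le> \<theta>" "\<theta> \<le> 2 * pi"
proof -
  have "y \<bullet> y = 1" using assms by (simp add: norm_eq_1)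
  then have sq: "(y $ 1)\<^sup>2 + (y $ 2)\<^sup>2 + (y $ 3)\<^sup>2 = 1"
    by (simp add: inner_vec_def sum_3 power2_eq_square)
  have "(y $ 3)\<^sup>2 \<le> 1" using sq zero_le_power2[of "y $ 1"] zero_le_power2[of "y $ 2"] by linarith
  then have abs: "\<bar>y $ 3\<bar> \<le> 1" by (simp add: abs_square_le_1)
  define \<phi> where "\<phi> = arccos (y $ 3)"
  have \<phi>: "cos \<phi> = y $ 3" "0 \<le> \<phi>" "\<phi> \<le> pi"
    using abs by (auto simp: \<phi>_def cos_arccos_abs abs_le_iff intro!: arccos_lbound arccos_ubound)
  have r: "(y $ 1)\<^sup>2 + (y $ 2)\<^sup>2 = (sin \<phi>)\<^sup>2"
    using sq by (simp add: sin_squared_eq \<phi>)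
  obtain \<theta> where \<theta>: "0 \<le> \<theta>" "\<theta> \<le> 2 * pi" "y $ 1 = sin \<phi> * cos \<theta>" "y $ 2 = sin \<phi> * sin \<theta>"
  proof (cases "sin \<phi> = 0")
    \<comment> \<open>At a pole the longitude is arbitrary; 0 is taken.\<close>
    case True
    with r have "y $ 1 = 0" "y $ 2 = 0"
      by (simp_all add: sum_power2_eq_zero_iff)
    with True show ?thesis using that[of 0] by simp
  next
    case False
    with r have "(y $ 1 / sin \<phi>)\<^sup>2 + (y $ 2 / sin \<phi>)\<^sup>2 = 1"
      by (simp add: power_divide add_divide_distrib[symmetric])
    then obtain t where "0 \<le> t" "t \<le> 2 * pi" "y $ 1 / sin \<phi> = cos t" "y $ 2 / sin \<phi> = sin t"
      using sincos_total_2pi_le by blast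
    with False show ?thesis using that[of t] by (simp add: field_simps)
  qed
  have "y = spherical \<phi> \<theta>"
    by (simp add: vec_eq_iff forall_3 spherical_def \<theta> \<phi>)
  with \<theta> \<phi> show ?thesis using that by blast
qed

lemma ring_of_height:
  assumes "k \<ge> 1" "-1 \<le> z" "z \<le> 1"
  obtains i where "1 \<le> i" "i \<le> 4 * k" "1 \<le> ring_size k i"
    "ring_boundary k i \<le> z" "z \<le> ring_boundary k (i - 1)"
proof -
  define i where "i = (LEAST i. ring_boundary k i \<le> z)"
  have ex: "ring_boundary k (4 * k) \<le> z" using assms by (simp add: ring_boundary_last)
  have i: "ring_boundary k i \<le> z" "i \<le> 4 * k"
    using LeastI[of "\<lambda>i. ring_boundary k i \<le> z", OF ex]
      Least_le[of "\<lambda>i. ring_boundary k i \<le> z", OF ex] by (auto simp: i_def)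
  show ?thesis
  proof (cases i)
    \<comment> \<open>Only the north pole has least index 0; it is assigned to ring 1.\<close>
    case 0
    with i assms have "z = 1" by simp
    moreover have "ring_boundary k 1 \<le> 1" using ring_boundary_bounds[OF assms(1), of 1] assms by simp
    ultimately show ?thesis using that[of 1] assms by (simp add: ring_size_def)
  next
    case (Suc m)
    then have "z < ring_boundary k m"
      using not_less_Least[of m "\<lambda>i. ring_boundary k i \<le> z"] by (simp add: i_def[symmetric])
    \<comment> \<open>The boundary drops strictly at the least index, so its ring is not
      empty.\<close>
    with i(1) Suc have "ring_size k i \<noteq> 0"
      using ring_boundary_Suc[of k m] by (intro notI) simp
    with Suc i \<open>z < ring_boundary k m\<close> show ?thesis using that[of i] by simp
  qed
qed

lemma ceiling_index:
  fixes x :: real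
  assumes "0 \<le> x" "x \<le> real n" "1 \<le> n"
  obtains j where "1 \<le> j" "j \<le> n" "real j - 1 \<le> x" "x \<le> real j"
proof (cases "x = 0")
  \<comment> \<open>The ceiling of 0 would be the invalid index 0.\<close>
  case True
  then show ?thesis using that[of 1] assms by simp
next
  case False
  then have "1 \<le> nat \<lceil>x\<rceil>" "nat \<lceil>x\<rceil> \<le> n" "real (nat \<lceil>x\<rceil>) - 1 \<le> x" "x \<le> real (nat \<lceil>x\<rceil>)"
    using assms by (auto simp: ceiling_le_iff le_nat_iff)
  then show ?thesis using that by blast
qed

lemma healpix_covering:
  assumes "k \<ge> 1" "y \<in> S2"
  shows "\<exists>x\<in>healpix k. norm (x - y) \<le> 4 / real k"
proof -
  obtain \<phi> \<theta> where y: "y = spherical \<phi> \<theta>" and \<phi>: "0 \<le> \<phi>" "\<phi> \<le> pi" and \<theta>: "0 \<le> \<theta>" "\<theta> \<le> 2 * pi"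
    using assms(2) by (rule S2_spherical_coordinates)
  obtain i where i: "1 \<le> i" "i \<le> 4 * k" "1 \<le> ring_size k i"
    "ring_boundary k i \<le> cos \<phi>" "cos \<phi> \<le> ring_boundary k (i - 1)"
    using ring_of_height[OF assms(1) cos_ge_minus_one cos_le_one] by blast
  let ?n = "real (ring_size k i)"
  have n: "?n > 0" using i by simp
  have "0 \<le> \<theta> * ?n / (2 * pi)" "\<theta> * ?n / (2 * pi) \<le> ?n"
    using \<theta> n by (simp_all add: field_simps)
  then obtain j where j: "1 \<le> j" "j \<le> ring_size k i"
    "real j - 1 \<le> \<theta> * ?n / (2 * pi)" "\<theta> * ?n / (2 * pi) \<le> real j"
    using i(3) by (rule ceiling_index)
  have ij: "(i, j) \<in> healpix_index k" using i j by (simp add: healpix_index_def)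
  have "2 * pi / ?n * (real j - 1) \<le> \<theta>" "\<theta> \<le> 2 * pi / ?n * real j"
    using j(3,4) n by (simp_all add: field_simps)
  from norm_healpix_point_cell_le[OF assms(1) ij \<phi> i(4,5) this]
  show ?thesis
    using ij by (auto simp: y healpix_eq_image[OF assms(1)] norm_minus_commute intro!: bexI[of _ "(i, j)"])
qed

section \<open>Covering radius and mesh ratio\<close>

lemma covering_radius_healpix:
  assumes "k \<ge> 1"
  shows "0 \<le> covering_radius (healpix k)" "covering_radius (healpix k) \<le> 4 / real k"
proof -
  let ?m = "\<lambda>y. MIN x\<in>healpix k. norm (x - y)"
  have fin: "finite (healpix k)" using assms by (rule finite_healpix)
  have S2: "spherical 0 0 \<in> S2" by simp
  have ne: "healpix k \<noteq> {}" using healpix_covering[OF assms S2] by blast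
  have le: "?m y \<le> 4 / real k" if "y \<in> S2" for y
    using healpix_covering[OF assms that] fin by (auto intro: Min.coboundedI order_trans)
  then show "covering_radius (healpix k) \<le> 4 / real k"
    unfolding covering_radius_def using S2 by (intro cSUP_least) blast+
  have "0 \<le> ?m (spherical 0 0)"
    using fin ne by (simp add: Min_ge_iff)
  then show "0 \<le> covering_radius (healpix k)"
    unfolding covering_radius_def using S2 le
    by (intro cSUP_upper2[of _ _ "spherical 0 0"] bdd_aboveI2) auto
qed

lemma mesh_ratio_healpix:
  assumes "k \<ge> 1"
  shows "\<bar>mesh_ratio (healpix k)\<bar> \<le> 8"
proof -
  have k: "real k > 0" using assms by simp
  have "0 < 1 / (2 * real k)" using k by simp
  then have "0 < separation (healpix k)"
    using separation_healpix_ge[OF assms] by linarith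
  moreover have "covering_radius (healpix k) / separation (healpix k) \<le> (4 / real k) / (1 / (2 * real k))"
    using covering_radius_healpix[OF assms] separation_healpix_ge[OF assms] k
    by (intro frac_le) auto
  ultimately show ?thesis
    using covering_radius_healpix(1)[OF assms] k by (simp add: mesh_ratio_def)
qed

section \<open>Equidistribution\<close>

text \<open>The sphere measure is the image of this one. Integrals are computed here because the
  cells are plain boxes in the parameter rectangle.\<close>

definition spherical_param_measure :: "(real \<times> real) measure" where
  "spherical_param_measure = density (restrict_space lborel ({0..pi} \<times> {0..2 * pi}))
     (\<lambda>(\<phi>, \<theta>). ennreal (sin \<phi> / (4 * pi)))"

lemma sets_param [simp, measurable]: "{0..pi} \<times> {0..2 * pi} \<in> sets (borel :: (real \<times> real) measure)"
  by (intro borel_closed closed_Times) auto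

lemma spherical_param_measurable [measurable]:
  "(\<lambda>(\<phi>, \<theta>). spherical \<phi> \<theta>) \<in> spherical_param_measure \<rightarrow>\<^sub>M S2_borel"
  using measurable_restrict_space1[OF spherical_measurable, of "{0..pi} \<times> {0..2 * pi}"]
  by (simp add: spherical_param_measure_def measurable_def space_restrict_space sets_restrict_space)

lemma sphere_measure_eq: "sphere_measure = distr spherical_param_measure S2_borel (\<lambda>(\<phi>, \<theta>). spherical \<phi> \<theta>)"
  by (simp add: sphere_measure_def spherical_param_measure_def)

lemma prob_space_spherical_param_measure: "prob_space spherical_param_measure"
proof
  have "S2 \<in> sets S2_borel"
    using sets.top[of S2_borel] by (simp add: space_restrict_space)
  then have "emeasure spherical_param_measure ((\<lambda>(\<phi>, \<theta>). spherical \<phi> \<theta>) -` S2 \<inter> space spherical_param_measure) = 1"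
    using emeasure_sphere_measure_S2
    by (simp add: sphere_measure_eq emeasure_distr[OF spherical_param_measurable])
  moreover have "(\<lambda>(\<phi>, \<theta>). spherical \<phi> \<theta>) -` S2 \<inter> space spherical_param_measure = space spherical_param_measure"
    by auto
  ultimately show "emeasure spherical_param_measure (space spherical_param_measure) = 1"
    by simp
qed

section \<open>Area of boxes and equal-area cells\<close>

lemma box_in_sets_param:
  assumes "0 \<le> a" "b \<le> pi" "0 \<le> c" "d \<le> 2 * pi"
  shows "{a..<b} \<times> {c<..d} \<in> sets spherical_param_measure"
proof -
  have "{a..<b} \<times> {c<..d} \<in> sets (borel :: (real \<times> real) measure)"
    unfolding borel_prod[symmetric] by (intro pair_measureI) auto
  moreover have "{a..<b} \<times> {c<..d} = ({0..pi} \<times> {0..2 * pi}) \<inter> ({a..<b} \<times> {c<..d})"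
    using assms by auto
  ultimately show ?thesis
    by (auto simp: spherical_param_measure_def sets_restrict_space)
qed

text \<open>Archimedes: integrating the sine makes the area of a zone proportional to its
  height.\<close>

lemma emeasure_spherical_param_box:
  assumes "0 \<le> a" "a \<le> b" "b \<le> pi" "0 \<le> c" "c \<le> d" "d \<le> 2 * pi"
  shows "emeasure spherical_param_measure ({a..<b} \<times> {c<..d}) = ennreal ((cos a - cos b) * (d - c) / (4 * pi))"
proof -
  let ?R = "{0..pi} \<times> {0..2 * pi}" and ?B = "{a..<b} \<times> {c<..d}"
  let ?f = "\<lambda>(\<phi>, \<theta>). ennreal (sin \<phi> / (4 * pi))"
  have dens: "?f \<in> borel_measurable (borel :: (real \<times> real) measure)"
    unfolding case_prod_beta
    by (intro measurable_compose[OF _ measurable_ennreal] borel_measurable_continuous_onI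
        continuous_intros) auto
  have dens': "?f \<in> borel_measurable (restrict_space lborel ?R)"
    using dens by (intro measurable_restrict_space1) simp
  have B: "?B \<in> sets (borel :: (real \<times> real) measure)"
    unfolding borel_prod[symmetric] by (intro pair_measureI) auto
  have FTC: "(\<integral>\<^sup>+\<phi>. ennreal (sin \<phi> * C) * indicator {a..b} \<phi> \<partial>lborel)
      = ennreal (- cos b * C - - cos a * C)" if "0 \<le> C" for C
    using assms that
    by (intro nn_integral_FTC_Icc[where F = "\<lambda>\<phi>. - cos \<phi> * C"])
       (auto intro!: derivative_eq_intros sin_ge_zero mult_nonneg_nonneg)
  have "emeasure spherical_param_measure ?B = (\<integral>\<^sup>+x. ?f x * indicator ?B x \<partial>restrict_space lborel ?R)"
    unfolding spherical_param_measure_def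
    using box_in_sets_param[of a b c d] assms
    by (intro emeasure_density[OF dens']) (simp add: spherical_param_measure_def)
  also have "\<dots> = (\<integral>\<^sup>+x. ?f x * indicator ?B x \<partial>lborel)"
    using assms by (subst nn_integral_restrict_space) (auto intro!: nn_integral_cong split: split_indicator)
  also have "\<dots> = (\<integral>\<^sup>+\<phi>. \<integral>\<^sup>+\<theta>. ?f (\<phi>, \<theta>) * indicator ?B (\<phi>, \<theta>) \<partial>lborel \<partial>lborel)"
  proof -
    have "(\<lambda>x. ?f x * indicator ?B x) \<in> borel_measurable (lborel \<Otimes>\<^sub>M lborel)"
      unfolding lborel_prod using dens B by simp
    from lborel.nn_integral_fst[OF this] show ?thesis by (simp add: lborel_prod)
  qed
  also have "\<dots> = (\<integral>\<^sup>+\<phi>. ennreal (sin \<phi> * ((d - c) / (4 * pi))) * indicator {a..b} \<phi> \<partial>lborel)"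
  proof (rule nn_integral_cong_AE)
    \<comment> \<open>The half-open colatitude interval is closed up for the fundamental theorem;
      only the null set where the colatitude is \<open>b\<close> changes.\<close>
    have "AE \<phi> in lborel. \<phi> \<noteq> b" by (rule AE_lborel_singleton)
    then show "AE \<phi> in lborel. (\<integral>\<^sup>+\<theta>. ?f (\<phi>, \<theta>) * indicator ?B (\<phi>, \<theta>) \<partial>lborel)
        = ennreal (sin \<phi> * ((d - c) / (4 * pi))) * indicator {a..b} \<phi>"
    proof eventually_elim
      case (elim \<phi>)
      have "(\<integral>\<^sup>+\<theta>. ?f (\<phi>, \<theta>) * indicator ?B (\<phi>, \<theta>) \<partial>lborel)
          = (\<integral>\<^sup>+\<theta>. (ennreal (sin \<phi> / (4 * pi)) * indicator {a..b} \<phi>) * indicator {c<..d} \<theta> \<partial>lborel)"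
        using elim by (intro nn_integral_cong) (auto split: split_indicator)
      also have "\<dots> = (ennreal (sin \<phi> / (4 * pi)) * indicator {a..b} \<phi>) * ennreal (d - c)"
        using assms by (subst nn_integral_cmult_indicator) auto
      also have "\<dots> = ennreal (sin \<phi> * ((d - c) / (4 * pi))) * indicator {a..b} \<phi>"
        using assms by (auto split: split_indicator simp: ennreal_mult''[symmetric])
      finally show ?case .
    qed
  qed
  also have "\<dots> = ennreal (- cos b * ((d - c) / (4 * pi)) - - cos a * ((d - c) / (4 * pi)))"
    using assms by (intro FTC) simp
  also have "- cos b * ((d - c) / (4 * pi)) - - cos a * ((d - c) / (4 * pi)) = (cos a - cos b) * (d - c) / (4 * pi)"
    by (simp add: diff_divide_distrib[symmetric] algebra_simps)
  finally show ?thesis .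
qed

text \<open>Half-open sides make the cells disjoint. The edges with colatitude pi or longitude 0 are
  left out, a null set.\<close>

definition healpix_cell :: "nat \<Rightarrow> nat \<times> nat \<Rightarrow> (real \<times> real) set" where
  "healpix_cell k = (\<lambda>(i, j).
     {arccos (ring_boundary k (i - 1))..<arccos (ring_boundary k i)} \<times>
     {2 * pi / real (ring_size k i) * (real j - 1)<..2 * pi / real (ring_size k i) * real j})"

lemma healpix_cell_bounds:
  assumes "k \<ge> 1" "(i, j) \<in> healpix_index k"
  shows "0 \<le> arccos (ring_boundary k (i - 1))" "arccos (ring_boundary k i) \<le> pi"
    "arccos (ring_boundary k (i - 1)) \<le> arccos (ring_boundary k i)"
    "cos (arccos (ring_boundary k (i - 1))) = ring_boundary k (i - 1)"
    "cos (arccos (ring_boundary k i)) = ring_boundary k i"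
    "0 \<le> 2 * pi / real (ring_size k i) * (real j - 1)"
    "2 * pi / real (ring_size k i) * (real j - 1) \<le> 2 * pi / real (ring_size k i) * real j"
    "2 * pi / real (ring_size k i) * real j \<le> 2 * pi"
proof -
  have i: "i \<le> 4 * k" "i - 1 \<le> 4 * k" and j: "1 \<le> j" "j \<le> ring_size k i"
    using assms(2) by (auto simp: healpix_index_def)
  note b = ring_boundary_bounds[OF assms(1) i(1)] ring_boundary_bounds[OF assms(1) i(2)]
  show "0 \<le> arccos (ring_boundary k (i - 1))" "arccos (ring_boundary k i) \<le> pi"
    "cos (arccos (ring_boundary k (i - 1))) = ring_boundary k (i - 1)"
    "cos (arccos (ring_boundary k i)) = ring_boundary k i"
    using b by (simp_all add: arccos_lbound arccos_ubound)
  show "arccos (ring_boundary k (i - 1)) \<le> arccos (ring_boundary k i)"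
    using b by (intro arccos_le_arccos ring_boundary_antimono) auto
  show "0 \<le> 2 * pi / real (ring_size k i) * (real j - 1)" using j by simp
  show "2 * pi / real (ring_size k i) * (real j - 1) \<le> 2 * pi / real (ring_size k i) * real j"
    by (intro mult_left_mono) auto
  show "2 * pi / real (ring_size k i) * real j \<le> 2 * pi"
    using j by (simp add: field_simps)
qed

lemma sets_healpix_cell:
  assumes "k \<ge> 1" "p \<in> healpix_index k"
  shows "healpix_cell k p \<in> sets spherical_param_measure"
  using assms healpix_cell_bounds[of k "fst p" "snd p"]
  by (auto simp: healpix_cell_def case_prod_beta intro!: box_in_sets_param)

text \<open>The zone has height n / (6k^2) and the cell has width 2 pi / n, so n cancels.\<close>

lemma measure_healpix_cell:
  assumes "k \<ge> 1" "p \<in> healpix_index k"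
  shows "measure spherical_param_measure (healpix_cell k p) = 1 / (12 * (real k)\<^sup>2)"
proof -
  obtain i j where p: "p = (i, j)" by (metis surj_pair)
  have ij: "(i, j) \<in> healpix_index k" using assms p by simp
  note bounds = healpix_cell_bounds[OF assms(1) ij]
  let ?n = "real (ring_size k i)"
  have i: "1 \<le> i" and n: "?n > 0" using ij by (auto simp: healpix_index_def)
  have "ring_boundary k (i - 1) - ring_boundary k i = ?n / (6 * (real k)\<^sup>2)"
    using ring_boundary_Suc[of k "i - 1"] i by simp
  moreover have "2 * pi / ?n * real j - 2 * pi / ?n * (real j - 1) = 2 * pi / ?n"
    by (simp add: right_diff_distrib)
  moreover have "?n / (6 * (real k)\<^sup>2) * (2 * pi / ?n) / (4 * pi) = 1 / (12 * (real k)\<^sup>2)"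
    using n assms(1) by (simp add: field_simps)
  ultimately have "emeasure spherical_param_measure (healpix_cell k p) = ennreal (1 / (12 * (real k)\<^sup>2))"
    using emeasure_spherical_param_box[OF bounds(1,3,2,6,7,8)] unfolding bounds(4,5)
    by (simp add: p healpix_cell_def)
  then show ?thesis by (simp add: measure_def)
qed

lemma disjoint_healpix_cells:
  assumes "k \<ge> 1"
  shows "disjoint_family_on (healpix_cell k) (healpix_index k)"
proof -
  have rings: "arccos (ring_boundary k i) \<le> arccos (ring_boundary k (i' - 1))"
    if "(i', j') \<in> healpix_index k" "i < i'" for i i' j'
    using that ring_boundary_bounds[OF assms, of i] ring_boundary_bounds[OF assms, of "i' - 1"]
    by (intro arccos_le_arccos ring_boundary_antimono) (auto simp: healpix_index_def)
  have lons: "2 * pi / n * real j \<le> 2 * pi / n * (real j' - 1)" if "j < j'" "0 \<le> n" for n j j'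
    using that by (intro mult_left_mono) auto
  have "(i, j) = (i', j')"
    if p: "(i, j) \<in> healpix_index k" "(i', j') \<in> healpix_index k"
      and x: "(\<phi>, \<theta>) \<in> healpix_cell k (i, j)" "(\<phi>, \<theta>) \<in> healpix_cell k (i', j')" for i j i' j' \<phi> \<theta>
  proof -
    have "i = i'"
      using rings[OF p(2), of i] rings[OF p(1), of i'] x
      by (cases i i' rule: linorder_cases) (auto simp: healpix_cell_def)
    moreover from this have "j = j'"
      using lons[of j j' "real (ring_size k i)"] lons[of j' j "real (ring_size k i)"] x
      by (cases j j' rule: linorder_cases) (auto simp: healpix_cell_def)
    ultimately show ?thesis by simp
  qed
  then show ?thesis
    unfolding disjoint_family_on_def by fast
qed

text \<open>The sum is the integral of the step function \<open>h\<close> with value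
  \<open>y i\<close> on \<open>A i\<close>. Disjoint cells of total probability 1 cover almost every
  point, and there \<open>g\<close> and \<open>h\<close> differ by at most the given error.\<close>

lemma (in prob_space) abs_integral_minus_cell_sum_le:
  fixes g :: "'a \<Rightarrow> real"
  assumes "finite I" "\<And>i. i \<in> I \<Longrightarrow> A i \<in> events" "disjoint_family_on A I"
    and "(\<Sum>i\<in>I. prob (A i)) = 1" "integrable M g"
    and close: "\<And>i x. i \<in> I \<Longrightarrow> x \<in> A i \<Longrightarrow> \<bar>g x - y i\<bar> \<le> \<epsilon>"
  shows "\<bar>expectation g - (\<Sum>i\<in>I. prob (A i) * y i)\<bar> \<le> \<epsilon>"
proof -
  define h where "h = (\<lambda>x. \<Sum>i\<in>I. indicator (A i) x * y i)"
  have int: "integrable M (\<lambda>x. indicator (A i) x * y i)" if "i \<in> I" for i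
    using assms(2)[OF that] by (auto intro!: integrable_mult_left simp: less_top[symmetric])
  have h: "integrable M h" "expectation h = (\<Sum>i\<in>I. prob (A i) * y i)"
    unfolding h_def using int assms(2) sets.sets_into_space
    by (auto simp: Bochner_Integration.integral_sum Int_absorb2 intro!: sum.cong)
  have "prob (\<Union>i\<in>I. A i) = 1"
    using assms by (subst finite_measure_finite_Union) auto
  then have "AE x in M. x \<in> (\<Union>i\<in>I. A i)"
    using assms(1,2) by (subst (asm) prob_eq_1) auto
  then have "AE x in M. \<bar>g x - h x\<bar> \<le> \<epsilon>"
  proof eventually_elim
    case (elim x)
    then obtain i where i: "i \<in> I" "x \<in> A i" by blast
    have "indicator (A j) x * y j = (if j = i then y i else 0)" if "j \<in> I" for j
      using i that assms(3) by (auto simp: disjoint_family_on_def split: split_indicator)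
    then have "h x = (\<Sum>j\<in>I. if j = i then y i else 0)"
      unfolding h_def by (intro sum.cong refl)
    then have "h x = y i" using i assms(1) by simp
    then show ?case using close[OF i] by simp
  qed
  then have "expectation (\<lambda>x. \<bar>g x - h x\<bar>) \<le> \<epsilon>"
    using assms(5) h by (intro integral_le_const) auto
  moreover have "\<bar>expectation (\<lambda>x. g x - h x)\<bar> \<le> expectation (\<lambda>x. \<bar>g x - h x\<bar>)"
    by (rule integral_abs_bound)
  ultimately show ?thesis
    using assms(5) h by simp
qed

section \<open>Quadrature error and convergence\<close>

lemma integral_normalized_counting_measure:
  fixes f :: "real ^ 3 \<Rightarrow> real"
  assumes "finite \<omega>" "\<omega> \<subseteq> S2" "continuous_on S2 f"
  shows "integral\<^sup>L (normalized_counting_measure \<omega>) f = (\<Sum>x\<in>\<omega>. f x) / real (card \<omega>)"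
proof -
  have "f \<in> borel_measurable S2_borel"
    using assms(3) by (rule borel_measurable_continuous_on_restrict)
  moreover have "(\<lambda>x. x) \<in> uniform_count_measure \<omega> \<rightarrow>\<^sub>M S2_borel"
    using assms(2) by (auto simp: measurable_def space_restrict_space sets_uniform_count_measure
      space_uniform_count_measure)
  ultimately show ?thesis
    unfolding normalized_counting_measure_def
    using assms(1) by (simp add: integral_distr integral_uniform_count_measure)
qed

text \<open>All cells have probability 1 / (12k^2), so the average over the configuration is exactly
  the cell sum with the value of \<open>f\<close> at the HEALPix point of each cell.\<close>

lemma healpix_quadrature_error:
  fixes f :: "real ^ 3 \<Rightarrow> real"
  assumes "k \<ge> 1" "continuous_on S2 f"
    and osc: "\<And>x y. x \<in> S2 \<Longrightarrow> y \<in> S2 \<Longrightarrow> norm (x - y) \<le> 4 / real k \<Longrightarrow> \<bar>f x - f y\<bar> \<le> \<epsilon>"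
  shows "\<bar>integral\<^sup>L sphere_measure f - integral\<^sup>L (normalized_counting_measure (healpix k)) f\<bar> \<le> \<epsilon>"
proof -
  interpret P: prob_space spherical_param_measure by (rule prob_space_spherical_param_measure)
  define g where "g = (\<lambda>(\<phi>, \<theta>). f (spherical \<phi> \<theta>))"
  have f: "f \<in> borel_measurable S2_borel"
    using assms(2) by (rule borel_measurable_continuous_on_restrict)
  have g_eq: "g = f \<circ> (\<lambda>(\<phi>, \<theta>). spherical \<phi> \<theta>)" by (auto simp: g_def)
  have g: "g \<in> borel_measurable spherical_param_measure"
    unfolding g_eq using spherical_param_measurable f by (rule measurable_comp)
  have "bounded (f ` S2)"
    using assms(2) by (intro compact_imp_bounded compact_continuous_image) auto
  then obtain B where B: "\<And>x. x \<in> S2 \<Longrightarrow> \<bar>f x\<bar> \<le> B"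
    by (metis bounded_iff image_eqI real_norm_def)
  have int: "integrable spherical_param_measure g"
    using g B by (intro P.integrable_const_bound[of _ B]) (auto simp: g_def)
  have sphere: "integral\<^sup>L sphere_measure f = integral\<^sup>L spherical_param_measure g"
    unfolding sphere_measure_eq g_eq comp_def
    by (rule integral_distr[OF spherical_param_measurable f])
  have close: "\<bar>g x - f (healpix_point k p)\<bar> \<le> \<epsilon>"
    if p: "p \<in> healpix_index k" and x: "x \<in> healpix_cell k p" for p x
  proof -
    obtain i j \<phi> \<theta> where eq: "p = (i, j)" "x = (\<phi>, \<theta>)" by (metis surj_pair)
    have ij: "(i, j) \<in> healpix_index k" using p eq by simp
    note bounds = healpix_cell_bounds[OF assms(1) ij]
    have \<phi>: "arccos (ring_boundary k (i - 1)) \<le> \<phi>" "\<phi> \<le> arccos (ring_boundary k i)"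
      and \<theta>: "2 * pi / real (ring_size k i) * (real j - 1) \<le> \<theta>"
        "\<theta> \<le> 2 * pi / real (ring_size k i) * real j"
      using x by (auto simp: eq healpix_cell_def)
    have 1: "0 \<le> \<phi>" "\<phi> \<le> pi" using \<phi> bounds(1,2) by linarith+
    have "cos (arccos (ring_boundary k i)) \<le> cos \<phi>" "cos \<phi> \<le> cos (arccos (ring_boundary k (i - 1)))"
      using \<phi> 1 bounds(1,2) by (intro cos_monotone_0_pi_le; simp)+
    then have "norm (spherical \<phi> \<theta> - healpix_point k (i, j)) \<le> 4 / real k"
      using bounds(4,5) by (intro norm_healpix_point_cell_le[OF assms(1) ij 1 _ _ \<theta>]) auto
    then show ?thesis
      unfolding g_def eq prod.case by (intro osc) (auto simp: healpix_point_def)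
  qed
  have meas: "P.prob (healpix_cell k p) = 1 / (12 * (real k)\<^sup>2)" if "p \<in> healpix_index k" for p
    using measure_healpix_cell[OF assms(1) that] .
  have "(\<Sum>p\<in>healpix_index k. P.prob (healpix_cell k p)) = 1"
    using meas assms(1) by (simp add: card_healpix_index)
  then have "\<bar>P.expectation g - (\<Sum>p\<in>healpix_index k. P.prob (healpix_cell k p) * f (healpix_point k p))\<bar> \<le> \<epsilon>"
    using int close
    by (intro P.abs_integral_minus_cell_sum_le disjoint_healpix_cells sets_healpix_cell assms(1)) auto
  moreover have "(\<Sum>x\<in>healpix k. f x) = (\<Sum>p\<in>healpix_index k. f (healpix_point k p))"
    unfolding healpix_eq_image[OF assms(1)]
    using inj_on_healpix_point[OF assms(1)] by (simp add: sum.reindex)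
  then have "(\<Sum>p\<in>healpix_index k. P.prob (healpix_cell k p) * f (healpix_point k p))
      = integral\<^sup>L (normalized_counting_measure (healpix k)) f"
    using meas assms(1,2)
    by (simp add: integral_normalized_counting_measure finite_healpix healpix_subset_S2 card_healpix
        sum_divide_distrib)
  ultimately show ?thesis by (simp add: sphere)
qed

lemma healpix_integral_tendsto:
  fixes f :: "real ^ 3 \<Rightarrow> real"
  assumes "continuous_on S2 f"
  shows "(\<lambda>k. integral\<^sup>L (normalized_counting_measure (healpix k)) f) \<longlonglongrightarrow> integral\<^sup>L sphere_measure f"
proof (rule LIMSEQ_I)
  fix r :: real assume r: "0 < r"
  have "uniformly_continuous_on S2 f"
    using assms by (intro compact_uniformly_continuous) auto
  \<comment> \<open>The quadrature bound is not strict, so the modulus is taken for r/2.\<close>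
  with r obtain d where d: "0 < d"
    "\<And>x y. x \<in> S2 \<Longrightarrow> y \<in> S2 \<Longrightarrow> norm (x - y) < d \<Longrightarrow> \<bar>f x - f y\<bar> < r / 2"
    unfolding uniformly_continuous_on_def dist_norm by (metis half_gt_zero real_norm_def)
  obtain k0 :: nat where k0: "4 / d < real k0" using reals_Archimedean2 by blast
  show "\<exists>no. \<forall>k\<ge>no. norm (integral\<^sup>L (normalized_counting_measure (healpix k)) f - integral\<^sup>L sphere_measure f) < r"
  proof (intro exI[of _ "max 1 k0"] allI impI)
    fix k assume k: "max 1 k0 \<le> k"
    then have "real k0 \<le> real k" by simp
    with k0 have "4 / d < real k" by linarith
    with d k have "4 / real k < d" by (simp add: field_simps)
    with d k have "\<bar>integral\<^sup>L sphere_measure f - integral\<^sup>L (normalized_counting_measure (healpix k)) f\<bar> \<le> r / 2"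
      by (intro healpix_quadrature_error[OF _ assms]) (auto intro: less_imp_le)
    with r show "norm (integral\<^sup>L (normalized_counting_measure (healpix k)) f - integral\<^sup>L sphere_measure f) < r"
      by (simp add: abs_minus_commute)
  qed
qed

section \<open>Passage from the parameter \<open>k\<close> to the number of points\<close>

theorem proposition4:
  fixes \<omega> :: "nat \<Rightarrow> (real ^ 3) set"
  assumes "\<And>k. k \<ge> 1 \<Longrightarrow> \<omega> (12 * k\<^sup>2) = healpix k"
  shows "equidistributed {12 * k\<^sup>2 | k. k \<ge> 1} \<omega> \<and> quasi_uniform {12 * k\<^sup>2 | k. k \<ge> 1} \<omega>"
proof -
  let ?I = "{12 * k\<^sup>2 | k :: nat. k \<ge> 1}"
  have I: "?I = (\<lambda>k. 12 * k\<^sup>2) ` {1..}" by auto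
  have "inj_on (\<lambda>k :: nat. 12 * k\<^sup>2) {1..}" by (auto simp: inj_on_def)
  then have "infinite ?I" unfolding I by (simp add: finite_image_iff infinite_Ici)
  moreover have "finite (\<omega> N) \<and> \<omega> N \<subseteq> S2 \<and> card (\<omega> N) = N" if "N \<in> ?I" for N
  proof -
    from that obtain k where "N = 12 * k\<^sup>2" "1 \<le> k" by blast
    with assms[of k] finite_healpix[of k] healpix_subset_S2[of k] card_healpix[of k]
    show ?thesis by simp
  qed
  ultimately have config: "config_sequence ?I \<omega>"
    unfolding config_sequence_def by blast
  have "((\<lambda>N. integral\<^sup>L (normalized_counting_measure (\<omega> N)) f) \<longlongrightarrow> integral\<^sup>L sphere_measure f)
      (inf sequentially (principal ?I))" if f: "continuous_on S2 f" for f :: "real ^ 3 \<Rightarrow> real"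
  proof (rule topological_tendstoI)
    fix S assume S: "open S" "integral\<^sup>L sphere_measure f \<in> S"
    from topological_tendstoD[OF healpix_integral_tendsto[OF f] S]
    obtain k0 where k0: "\<And>k. k0 \<le> k \<Longrightarrow> integral\<^sup>L (normalized_counting_measure (healpix k)) f \<in> S"
      unfolding eventually_sequentially by blast
    have "integral\<^sup>L (normalized_counting_measure (\<omega> N)) f \<in> S"
      if "12 * k0\<^sup>2 \<le> N" "N \<in> ?I" for N
    proof -
      from that(2) obtain k where k: "N = 12 * k\<^sup>2" "1 \<le> k" by blast
      \<comment> \<open>Since 12k^2 increases with k, a large number of points forces a large
        parameter.\<close>
      with that(1) have "k0 \<le> k" by simp
      with k0[of k] k assms show ?thesis by simp
    qed
    then show "\<forall>\<^sub>F N in inf sequentially (principal ?I).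
        integral\<^sup>L (normalized_counting_measure (\<omega> N)) f \<in> S"
      unfolding eventually_inf_principal eventually_sequentially by blast
  qed
  with config have "equidistributed ?I \<omega>" unfolding equidistributed_def by blast
  moreover have "quasi_uniform ?I \<omega>"
    unfolding quasi_uniform_def
  proof (intro conjI config ballI)
    fix N assume "N \<in> ?I"
    then obtain k where "N = 12 * k\<^sup>2" "1 \<le> k" by blast
    moreover from this have "12 * 1 \<le> 12 * k\<^sup>2" by (intro mult_left_mono) auto
    ultimately show "2 \<le> N" by simp
  next
    show "bounded ((\<lambda>N. mesh_ratio (\<omega> N)) ` ?I)"
      unfolding bounded_iff using assms mesh_ratio_healpix by (intro exI[of _ 8]) auto
  qed
  ultimately show ?thesis by blast
qed

end
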